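(* Let $\mathcal G$ be a connected unweighted graph on $n$ nodes. Then $$\frac12-\frac1{2n}\ \le\ \rho_{ss}(L_{\mathcal G};M_n)\ \le\ \frac{n^2-1}{12}.$$ Furthermore, the lower bound is achieved if and only if $\mathcal G=\mathcal K_n$ (the complete graph), and the upper bound is achieved if and only if $\mathcal G=\mathcal P_n$ (the path graph).
   Context: Graphs are finite, simple, undirected; equality of graphs is up to isomorphism. $L_{\mathcal G}$ is the graph Laplacian (degree matrix minus adjacency matrix) with eigenvalues $0=\lambda_1<\lambda_2\le\dots\le\lambda_n$, $M_n=I_n-\frac1nJ_n$ is the centering matrix ($J_n$ the all-ones matrix), and $\rho_{ss}(L_{\mathcal G};M_n)=\frac12\sum_{i=2}^n\lambda_i^{-1}$ is the performance measure of the first-order consensus network $\dot x=-L_{\mathcal G}x+\xi$, $y=M_nx$. *)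

theory Defs
  imports
    "Graph_Theory.Digraph_Isomorphism"
    "Graph_Theory.Kuratowski"
    "Jordan_Normal_Form.Char_Poly"
    "HOL-Computational_Algebra.Polynomial"
    "HOL-Library.Multiset"
begin

text \<open>
  A finite simple undirected graph is a \<open>pair_graph\<close>: a finite vertex set together with
  a symmetric irreflexive arc relation, every edge being a pair of opposite arcs.  Thus
  \<open>out_degree\<close> is the usual degree.  In the matrices below the list \<open>vs\<close> is a numbering
  of the vertices, meant to be distinct and to enumerate all of them.
\<close>

definition degree_mat :: "'a list \<Rightarrow> 'a pair_pre_digraph \<Rightarrow> real mat" where
  "degree_mat vs G = mat (length vs) (length vs)
     (\<lambda>(i, j). if i = j then real (out_degree (with_proj G) (vs ! i)) else 0)"

definition adjacency_mat :: "'a list \<Rightarrow> 'a pair_pre_digraph \<Rightarrow> real mat" where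
  "adjacency_mat vs G = mat (length vs) (length vs)
     (\<lambda>(i, j). if (vs ! i, vs ! j) \<in> parcs G then 1 else 0)"

definition laplacian_mat :: "'a list \<Rightarrow> 'a pair_pre_digraph \<Rightarrow> real mat" where
  "laplacian_mat vs G = degree_mat vs G - adjacency_mat vs G"

text \<open>
  The real eigenvalues in increasing order, repeated according to algebraic multiplicity.
  For a symmetric matrix of dimension \<open>n\<close> this list has length \<open>n\<close>, and
  \<open>sorted_eigenvalue A i\<close> is the \<open>i\<close>-th smallest eigenvalue, with \<open>i\<close> counted from 1.
\<close>

definition sorted_eigenvalues :: "real mat \<Rightarrow> real list" where
  "sorted_eigenvalues A = sorted_list_of_multiset (proots (char_poly A))"

definition sorted_eigenvalue :: "real mat \<Rightarrow> nat \<Rightarrow> real" where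
  "sorted_eigenvalue A i = sorted_eigenvalues A ! (i - 1)"

text \<open>
  The performance measure of the consensus network with state matrix \<open>- L\<close> and output
  \<open>y = M x\<close>, where \<open>M\<close> is the centering matrix; the smallest eigenvalue of \<open>L\<close>, which is
  0 for a graph Laplacian, is left out.
\<close>

definition rho_ss :: "real mat \<Rightarrow> real" where
  "rho_ss L = 1 / 2 * (\<Sum>i = 2..dim_row L. inverse (sorted_eigenvalue L i))"

definition path_graph :: "nat \<Rightarrow> nat pair_pre_digraph" where
  "path_graph n = \<lparr> pverts = {..<n},
     parcs = {(i, j). i < n \<and> j < n \<and> (j = Suc i \<or> i = Suc j)} \<rparr>"

end

theory Submission
  imports Defs "HOL-Computational_Algebra.Fundamental_Theorem_Algebra"
begin

text \<open>
  Let \<open>u\<^sub>1, \<dots>, u\<^sub>n\<close> be an orthonormal eigenbasis of the Laplacian \<open>L\<close>, which exists by the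
  spectral theorem (\<open>real_symmetric_diagonalization\<close>). The quadratic form of \<open>L\<close> is the energy
  \<open>\<Sum>(x\<^sub>a - x\<^sub>b)\<^sup>2\<close> over the edges \<open>ab\<close>, so a connected graph has exactly one zero eigenvalue,
  with constant eigenvector, and the claim concerns \<open>s = \<Sum> 1 / \<lambda>\<^sub>i\<close> over the others.

  Lower bound. The graph with \<open>m\<close> edges has \<open>\<Sum> \<lambda>\<^sub>i = 2 m \<le> n (n - 1)\<close>. Since \<open>1 / t\<close> lies
  above its tangent at \<open>t = n\<close>, this gives \<open>s \<ge> 2 (n - 1) / n - 2 m / n\<^sup>2 \<ge> (n - 1) / n\<close>, and
  equality forces all edges to be present; conversely all nonzero eigenvalues of the complete
  graph are \<open>n\<close>.

  Upper bound. With the effective resistances \<open>R\<^sub>a\<^sub>b\<close> of the graph, \<open>2 n s\<close> is the sum of all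
  \<open>R\<^sub>a\<^sub>b\<close> over ordered pairs (\<open>sum_resistance\<close>). A resistance is at most the length of any
  path between the two vertices, here one traced back through an order of discovery
  (\<open>resistance_growing_le\<close>). Discovering a connected set of size \<open>k\<close> from one of its vertices
  \<open>v\<close> therefore shows that the resistances from \<open>v\<close> sum to at most \<open>0 + 1 + \<dots> + (k - 1)\<close>. The
  graph is built by adding vertices one at a time while it stays connected, and these
  contributions, counted in both orders, add up to \<open>(n\<^sup>3 - n) / 3\<close>, the value for a path
  (\<open>connected_subset_sum_resistance\<close>). In the case of equality the last vertex has the maximal
  total resistance \<open>n (n - 1) / 2\<close>; then there is a single vertex at each resistance
  \<open>0, \<dots>, n - 1\<close> and only consecutive ones can be adjacent (\<open>path_labelling_if_extremal\<close>).
  Conversely a test function shows that resistances in a path are at least distances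
  (\<open>path_resistance_ge\<close>).
\<close>

section \<open>Orthogonal diagonalization of real symmetric matrices\<close>

text \<open>
  For a complex eigenvector \<open>v\<close> with eigenvalue \<open>k\<close>, the number \<open>v\<^sup>* A v\<close> equals \<open>k \<parallel>v\<parallel>\<^sup>2\<close>,
  and it is its own conjugate because \<open>A\<close> is real and symmetric.
\<close>
lemma symmetric_complex_eigenvalue_real:
  fixes A :: "real mat" and k :: complex
  assumes A: "A \<in> carrier_mat n n" and sym: "transpose_mat A = A"
    and ev: "eigenvalue (map_mat complex_of_real A) k"
  shows "k \<in> \<real>"
proof -
  from ev A obtain v where v: "v \<in> carrier_vec n" and v0: "v \<noteq> 0\<^sub>v n"
    and Av: "map_mat complex_of_real A *\<^sub>v v = k \<cdot>\<^sub>v v"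
    by (auto simp: eigenvalue_def eigenvector_def)
  have Aij: "A $$ (i, j) = A $$ (j, i)" if "i < n" "j < n" for i j
    using sym that A by (metis carrier_matD index_transpose_mat(1))
  have row: "k * v $ i = (\<Sum>j<n. complex_of_real (A $$ (i, j)) * v $ j)" if "i < n" for i
  proof -
    have "k * v $ i = (map_mat complex_of_real A *\<^sub>v v) $ i"
      using Av that v by simp
    also have "\<dots> = (\<Sum>j<n. complex_of_real (A $$ (i, j)) * v $ j)"
      using that A v by (auto simp: scalar_prod_def lessThan_atLeast0)
    finally show ?thesis .
  qed
  define q where "q = (\<Sum>i<n. \<Sum>j<n. cnj (v $ i) * complex_of_real (A $$ (i, j)) * v $ j)"
  define r where "r = (\<Sum>i<n. (cmod (v $ i))\<^sup>2)"
  have "q = (\<Sum>i<n. cnj (v $ i) * (k * v $ i))"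
    unfolding q_def by (intro sum.cong refl) (simp add: row sum_distrib_left mult.assoc)
  also have "\<dots> = k * complex_of_real r"
    unfolding r_def of_real_sum sum_distrib_left
    by (intro sum.cong refl) (simp add: complex_norm_square mult_ac del: of_real_power)
  finally have q: "q = k * complex_of_real r" .
  have "cnj q = (\<Sum>i<n. \<Sum>j<n. v $ i * complex_of_real (A $$ (i, j)) * cnj (v $ j))"
    by (simp add: q_def)
  also have "\<dots> = (\<Sum>j<n. \<Sum>i<n. v $ i * complex_of_real (A $$ (i, j)) * cnj (v $ j))"
    by (rule sum.swap)
  also have "\<dots> = q"
    unfolding q_def by (intro sum.cong refl) (simp add: Aij mult_ac)
  finally have "q \<in> \<real>" by (simp add: Reals_cnj_iff)
  moreover have "r \<noteq> 0"
  proof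
    assume "r = 0"
    then have "\<forall>i<n. v $ i = 0"
      unfolding r_def by (subst (asm) sum_nonneg_eq_0_iff) auto
    then have "v = 0\<^sub>v n" using v by (intro eq_vecI) auto
    with v0 show False by simp
  qed
  moreover have "k = q / complex_of_real r" using q \<open>r \<noteq> 0\<close> by simp
  ultimately show ?thesis by (metis Reals_divide Reals_of_real)
qed

text \<open>
  The characteristic polynomial has a complex root by the fundamental theorem of algebra. That
  root is real, hence already a root over the reals, and so has a real eigenvector.
\<close>
lemma symmetric_unit_eigenvector:
  fixes A :: "real mat"
  assumes A: "A \<in> carrier_mat n n" and sym: "transpose_mat A = A" and n: "0 < n"
  obtains k v where "v \<in> carrier_vec n" "v \<bullet> v = 1" "A *\<^sub>v v = k \<cdot>\<^sub>v v"
proof -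
  let ?C = "map_mat complex_of_real A"
  have C: "?C \<in> carrier_mat n n" using A by simp
  have "degree (char_poly ?C) = n" using degree_monic_char_poly[OF C] by simp
  then have "\<not> constant (poly (char_poly ?C))" using n by (simp add: constant_degree)
  then obtain z where z: "poly (char_poly ?C) z = 0"
    using fundamental_theorem_of_algebra by blast
  then have "z \<in> \<real>"
    using symmetric_complex_eigenvalue_real[OF A sym] eigenvalue_root_char_poly[OF C] by blast
  then obtain k where k: "z = complex_of_real k" by (auto elim: Reals_cases)
  have "poly (char_poly A) k = 0"
    using z unfolding k of_real_hom.char_poly_hom[OF A] by simp
  then have "eigenvalue A k" using eigenvalue_root_char_poly[OF A] by blast
  then obtain w where w: "w \<in> carrier_vec n" "w \<noteq> 0\<^sub>v n" "A *\<^sub>v w = k \<cdot>\<^sub>v w"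
    using A by (auto simp: eigenvalue_def eigenvector_def)
  have pos: "w \<bullet> w > 0"
    using conjugate_square_greater_0_vec[OF w(1)] w by simp
  define v where "v = (1 / sqrt (w \<bullet> w)) \<cdot>\<^sub>v w"
  have "v \<in> carrier_vec n" using w by (simp add: v_def)
  moreover have "v \<bullet> v = 1"
    using w pos by (simp add: v_def field_simps)
  moreover have "A *\<^sub>v v = k \<cdot>\<^sub>v v"
    using w A by (simp add: v_def mult_mat_vec smult_smult_assoc mult.commute)
  ultimately show ?thesis using that by blast
qed

text \<open>
  Completes a unit vector to an orthogonal matrix without any orthogonalization procedure: the
  reflection in the hyperplane orthogonal to \<open>v - e\<^sub>0\<close> exchanges \<open>v\<close> and the first unit vector
  \<open>e\<^sub>0\<close>. If \<open>v = e\<^sub>0\<close>, the division by zero below gives the identity.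
\<close>
lemma householder_reflection:
  fixes v :: "real vec"
  assumes v: "v \<in> carrier_vec n" and unit: "v \<bullet> v = 1" and n: "0 < n"
  obtains H where "H \<in> carrier_mat n n" "transpose_mat H = H" "H * H = 1\<^sub>m n" "col H 0 = v"
proof -
  define w where "w = v - unit_vec n 0"
  define s where "s = w \<bullet> w"
  define c where "c = 2 / s"
  define H where "H = mat n n (\<lambda>(i, j). (if i = j then 1 else 0) - c * (w $ i * w $ j))"
  have w: "w \<in> carrier_vec n" using v by (simp add: w_def)
  have wi: "w $ i = v $ i - (if i = 0 then 1 else 0)" if "i < n" for i
    using that v n by (simp add: w_def)
  have ssum: "s = (\<Sum>i<n. w $ i * w $ i)"
    using w by (simp add: s_def scalar_prod_def lessThan_atLeast0)
  have vsum: "(\<Sum>i<n. v $ i * v $ i) = 1"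
    using v unit by (simp add: scalar_prod_def lessThan_atLeast0)
  have "s = (\<Sum>i<n. v $ i * v $ i + (if i = 0 then 1 - 2 * v $ i else 0))"
    unfolding ssum by (intro sum.cong refl) (auto simp: wi algebra_simps)
  also have "\<dots> = 2 - 2 * v $ 0" using n vsum by (simp add: sum.distrib)
  \<comment> \<open>For \<open>w \<noteq> 0\<close> this value makes the coefficient of \<open>w\<close> in the first column \<open>- c * w $ 0 = 1\<close>.\<close>
  finally have s2: "s = - 2 * w $ 0" using n by (simp add: wi)
  have H: "H \<in> carrier_mat n n" by (simp add: H_def)
  moreover have "transpose_mat H = H"
    by (rule eq_matI) (auto simp: H_def mult_ac)
  moreover have "H * H = 1\<^sub>m n"
  proof (rule eq_matI)
    fix i j assume "i < dim_row (1\<^sub>m n :: real mat)" "j < dim_col (1\<^sub>m n :: real mat)"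
    then have i: "i < n" and j: "j < n" by auto
    have "(H * H) $$ (i, j) = (\<Sum>k<n. H $$ (i, k) * H $$ (k, j))"
      using i j H by (simp add: scalar_prod_def lessThan_atLeast0)
    also have "\<dots> = (\<Sum>k<n. (if i = k then (if k = j then 1 else 0) - c * (w $ k * w $ j) else 0)
        - (if k = j then c * (w $ i * w $ k) else 0) + c\<^sup>2 * w $ i * w $ j * (w $ k * w $ k))"
      by (intro sum.cong refl) (simp add: H_def i j power2_eq_square algebra_simps)
    also have "\<dots> = (if i = j then 1 else 0) - 2 * c * (w $ i * w $ j) + c\<^sup>2 * w $ i * w $ j * s"
      using i j by (simp add: sum.distrib sum_subtractf ssum sum_distrib_left algebra_simps)
    also have "c\<^sup>2 * w $ i * w $ j * s = 2 * c * (w $ i * w $ j)"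
      by (simp add: c_def power2_eq_square)
    finally show "(H * H) $$ (i, j) = 1\<^sub>m n $$ (i, j)" using i j by simp
  qed (use H in auto)
  moreover have "col H 0 = v"
  proof (rule eq_vecI)
    fix i assume "i < dim_vec v"
    then have i: "i < n" using v by simp
    show "col H 0 $ i = v $ i"
    proof (cases "s = 0")
      case True
      then have "\<forall>k<n. w $ k = 0"
        unfolding ssum by (subst (asm) sum_nonneg_eq_0_iff) auto
      then show ?thesis using i n wi[OF i] by (auto simp: H_def)
    next
      case False
      then have "c * w $ 0 = -1" using s2 by (simp add: c_def field_simps)
      then have "c * (w $ i * w $ 0) = - w $ i" by (metis mult.left_commute mult_minus1_right)
      then show ?thesis using i n by (simp add: H_def wi)
    qed
  qed (use H v in auto)
  ultimately show ?thesis using that by blast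
qed

text \<open>
  The spectral theorem, by induction on the dimension. A reflection that moves the first unit
  vector to a unit eigenvector conjugates \<open>A\<close> to a matrix whose first column is a multiple of
  the first unit vector; symmetry clears the first row as well, which leaves a smaller
  symmetric block.
\<close>
theorem real_symmetric_diagonalization:
  fixes A :: "real mat"
  assumes "A \<in> carrier_mat n n" and "transpose_mat A = A"
  shows "\<exists>U e. U \<in> carrier_mat n n \<and> transpose_mat U * U = 1\<^sub>m n
    \<and> transpose_mat U * A * U = mat_diag n e"
  using assms
proof (induction n arbitrary: A)
  case 0
  then show ?case
    by (intro exI[of _ "1\<^sub>m 0"] exI[of _ "\<lambda>_. 0"] conjI eq_matI) (auto simp: mat_diag_def)
next
  case (Suc n)
  note A = Suc.prems(1) and sym = Suc.prems(2)
  obtain k v where v: "v \<in> carrier_vec (Suc n)" "v \<bullet> v = 1" and Av: "A *\<^sub>v v = k \<cdot>\<^sub>v v"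
    using symmetric_unit_eigenvector[OF A sym] by blast
  obtain H where H: "H \<in> carrier_mat (Suc n) (Suc n)" and Ht: "transpose_mat H = H"
    and HH: "H * H = 1\<^sub>m (Suc n)" and Hv: "col H 0 = v"
    using householder_reflection[OF v] by blast
  define B where "B = H * A * H"
  have B: "B \<in> carrier_mat (Suc n) (Suc n)" using A H by (simp add: B_def)
  have "transpose_mat B = transpose_mat H * transpose_mat (H * A)"
    unfolding B_def using A H by (intro transpose_mult) auto
  also have "\<dots> = B"
    using A H by (simp add: transpose_mult[OF H A] Ht sym B_def assoc_mult_mat[of _ "Suc n" "Suc n" _ "Suc n" _ "Suc n"])
  finally have Bt: "transpose_mat B = B" .
  have Bsym: "B $$ (i, j) = B $$ (j, i)" if "i < Suc n" "j < Suc n" for i j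
    using Bt that B by (metis carrier_matD index_transpose_mat(1))
  have AHc: "A * H \<in> carrier_mat (Suc n) (Suc n)" using A H by simp
  have "B = H * (A * H)" unfolding B_def by (rule assoc_mult_mat[OF H A H])
  then have "col B 0 = H *\<^sub>v (A *\<^sub>v v)"
    by (metis col_mult2[OF H AHc zero_less_Suc] col_mult2[OF A H zero_less_Suc] Hv)
  also have "\<dots> = k \<cdot>\<^sub>v (H *\<^sub>v v)" using Av H v by (simp add: mult_mat_vec)
  also have "H *\<^sub>v v = col (H * H) 0" by (metis col_mult2[OF H H zero_less_Suc] Hv)
  also have "\<dots> = unit_vec (Suc n) 0" by (simp add: HH)
  finally have col0: "col B 0 = k \<cdot>\<^sub>v unit_vec (Suc n) 0" .
  have Bi0: "B $$ (i, 0) = (if i = 0 then k else 0)" if "i < Suc n" for i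
  proof -
    have "B $$ (i, 0) = col B 0 $ i" using that B by simp
    also have "\<dots> = (if i = 0 then k else 0)" unfolding col0 using that by simp
    finally show ?thesis .
  qed
  define C where "C = mat n n (\<lambda>(i, j). B $$ (Suc i, Suc j))"
  have C: "C \<in> carrier_mat n n" by (simp add: C_def)
  have "transpose_mat C = C" by (rule eq_matI) (auto simp: C_def Bsym)
  from Suc.IH[OF C this] obtain V e where V: "V \<in> carrier_mat n n"
    and VV: "transpose_mat V * V = 1\<^sub>m n" and VC: "transpose_mat V * C * V = mat_diag n e"
    by blast
  have Bblock: "B = four_block_mat (mat 1 1 (\<lambda>_. k)) (0\<^sub>m 1 n) (0\<^sub>m n 1) C"
  proof (rule eq_matI)
    fix i j
    assume "i < dim_row (four_block_mat (mat 1 1 (\<lambda>_. k)) (0\<^sub>m 1 n) (0\<^sub>m n 1) C)"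
      and "j < dim_col (four_block_mat (mat 1 1 (\<lambda>_. k)) (0\<^sub>m 1 n) (0\<^sub>m n 1) C)"
    then have ij: "i < Suc n" "j < Suc n" using C by auto
    then show "B $$ (i, j) = four_block_mat (mat 1 1 (\<lambda>_. k)) (0\<^sub>m 1 n) (0\<^sub>m n 1) C $$ (i, j)"
      using C Bi0[OF ij(1)] Bi0[OF ij(2)] Bsym[OF ij]
      by (cases i; cases j) (auto simp: C_def)
  qed (use B C in auto)
  define W where "W = four_block_mat (1\<^sub>m 1) (0\<^sub>m 1 n) (0\<^sub>m n 1) V"
  have W: "W \<in> carrier_mat (Suc n) (Suc n)"
    unfolding W_def using V by (metis four_block_carrier_mat one_carrier_mat plus_1_eq_Suc)
  have Wt: "transpose_mat W = four_block_mat (1\<^sub>m 1) (0\<^sub>m 1 n) (0\<^sub>m n 1) (transpose_mat V)"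
    unfolding W_def using V by (subst transpose_four_block_mat) auto
  have WW: "transpose_mat W * W = 1\<^sub>m (Suc n)"
  proof -
    have "transpose_mat W * W = four_block_mat (1\<^sub>m 1) (0\<^sub>m 1 n) (0\<^sub>m n 1) (1\<^sub>m n)"
      unfolding Wt unfolding W_def using V VV
      by (subst mult_four_block_mat[of _ 1 1 _ n _ n _ _ 1 _ n]) auto
    also have "\<dots> = 1\<^sub>m (Suc n)" by (rule eq_matI) auto
    finally show ?thesis .
  qed
  have WB: "transpose_mat W * B * W = mat_diag (Suc n) (case_nat k e)"
  proof -
    have "transpose_mat W * B * W
        = four_block_mat (mat 1 1 (\<lambda>_. k)) (0\<^sub>m 1 n) (0\<^sub>m n 1) (mat_diag n e)"
      unfolding Wt unfolding W_def Bblock using V C VC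
      by (subst mult_four_block_mat[of _ 1 1 _ n _ n _ _ 1 _ n]; (auto; fail)?)
         (subst mult_four_block_mat[of _ 1 1 _ n _ n _ _ 1 _ n]; auto)
    also have "\<dots> = mat_diag (Suc n) (case_nat k e)"
    proof (rule eq_matI)
      fix i j
      assume "i < dim_row (mat_diag (Suc n) (case_nat k e))"
        and "j < dim_col (mat_diag (Suc n) (case_nat k e))"
      then show "four_block_mat (mat 1 1 (\<lambda>_. k)) (0\<^sub>m 1 n) (0\<^sub>m n 1) (mat_diag n e) $$ (i, j)
          = mat_diag (Suc n) (case_nat k e) $$ (i, j)"
        by (cases i; cases j) (auto simp: mat_diag_def)
    qed (auto simp: mat_diag_def)
    finally show ?thesis .
  qed
  note assoc = assoc_mult_mat[of _ "Suc n" "Suc n" _ "Suc n" _ "Suc n"]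
  have Wtc: "transpose_mat W \<in> carrier_mat (Suc n) (Suc n)" using W by simp
  have tHW: "transpose_mat (H * W) = transpose_mat W * H"
    using transpose_mult[OF H W] Ht by simp
  have "transpose_mat (H * W) * (H * W) = transpose_mat W * ((H * H) * W)"
    unfolding tHW using H W Wtc by (simp add: assoc)
  also have "\<dots> = 1\<^sub>m (Suc n)" using W WW by (simp add: HH)
  finally have 1: "transpose_mat (H * W) * (H * W) = 1\<^sub>m (Suc n)" .
  have "transpose_mat (H * W) * A * (H * W) = transpose_mat W * B * W"
    unfolding tHW B_def using H W Wtc A by (simp add: assoc)
  with WB have 2: "transpose_mat (H * W) * A * (H * W) = mat_diag (Suc n) (case_nat k e)"
    by simp
  have "H * W \<in> carrier_mat (Suc n) (Suc n)" using H W by simp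
  with 1 2 show ?case by blast
qed

section \<open>Dirichlet energy and connected sets\<close>

text \<open>
  The Dirichlet energy of \<open>x\<close> on the subgraph induced by \<open>S\<close>. On the full vertex set it is the
  quadratic form of the Laplacian; the factor one half compensates for meeting every edge in
  both directions.
\<close>
definition energy :: "('v \<Rightarrow> 'v \<Rightarrow> bool) \<Rightarrow> 'v set \<Rightarrow> ('v \<Rightarrow> real) \<Rightarrow> real" where
  "energy E S x = (\<Sum>a\<in>S. \<Sum>b\<in>S. if E a b then (x a - x b)\<^sup>2 else 0) / 2"

text \<open>
  Connectedness of the induced subgraph, expressed by cuts instead of walks: in this form it
  says directly how a part grows by a new vertex.
\<close>
definition connected_on :: "('v \<Rightarrow> 'v \<Rightarrow> bool) \<Rightarrow> 'v set \<Rightarrow> bool" where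
  "connected_on E S \<longleftrightarrow> (\<forall>A. A \<subseteq> S \<and> A \<noteq> {} \<and> A \<noteq> S \<longrightarrow> (\<exists>a\<in>A. \<exists>b\<in>S - A. E a b))"

text \<open>
  An order of discovery of a connected graph, as any graph search produces it.
\<close>
definition growing :: "('v \<Rightarrow> 'v \<Rightarrow> bool) \<Rightarrow> 'v list \<Rightarrow> bool" where
  "growing E ws \<longleftrightarrow> distinct ws \<and> (\<forall>k<length ws. 0 < k \<longrightarrow> (\<exists>j<k. E (ws ! j) (ws ! k)))"

lemma energy_cong:
  assumes "\<And>a. a \<in> S \<Longrightarrow> x a = y a"
  shows "energy E S x = energy E S y"
  unfolding energy_def using assms by (intro arg_cong2[of _ _ _ _ "(/)"] sum.cong refl) auto

lemma energy_nonneg: "0 \<le> energy E S x"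
  unfolding energy_def by (intro divide_nonneg_pos sum_nonneg) auto

lemma energy_mono:
  assumes "finite T" "S \<subseteq> T"
  shows "energy E S x \<le> energy E T x"
proof -
  have "(\<Sum>a\<in>S. \<Sum>b\<in>S. if E a b then (x a - x b)\<^sup>2 else 0)
      \<le> (\<Sum>a\<in>S. \<Sum>b\<in>T. if E a b then (x a - x b)\<^sup>2 else 0)"
    using assms by (intro sum_mono sum_mono2) auto
  also have "\<dots> \<le> (\<Sum>a\<in>T. \<Sum>b\<in>T. if E a b then (x a - x b)\<^sup>2 else 0)"
    using assms by (intro sum_mono2 sum_nonneg) auto
  finally show ?thesis unfolding energy_def by simp
qed

lemma energy_insert:
  assumes "finite S" "w \<notin> S" "a \<in> S" "E a w" "E w a"
  shows "energy E S x + (x a - x w)\<^sup>2 \<le> energy E (insert w S) x"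
proof -
  define f where "f a b = (if E a b then (x a - x b)\<^sup>2 else 0)" for a b
  have nn: "f a b \<ge> 0" for a b by (simp add: f_def)
  have "(\<Sum>p\<in>insert w S. \<Sum>q\<in>insert w S. f p q)
      = f w w + (\<Sum>q\<in>S. f w q) + ((\<Sum>p\<in>S. f p w) + (\<Sum>p\<in>S. \<Sum>q\<in>S. f p q))"
    using assms by (simp add: sum.distrib)
  moreover have "f w a \<le> (\<Sum>q\<in>S. f w q)" "f a w \<le> (\<Sum>p\<in>S. f p w)"
    using assms nn by (auto intro: member_le_sum)
  moreover have "f w a = (x a - x w)\<^sup>2" "f a w = (x a - x w)\<^sup>2"
    using assms by (auto simp: f_def power2_commute)
  ultimately show ?thesis unfolding energy_def f_def[symmetric] using nn[of w w] by simp
qed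

lemma connected_on_insert:
  assumes S: "connected_on E S" and a: "a \<in> S" "E a w" and w: "E w a"
  shows "connected_on E (insert w S)"
  unfolding connected_on_def
proof (intro allI impI, elim conjE)
  fix A assume A: "A \<subseteq> insert w S" "A \<noteq> {}" "A \<noteq> insert w S"
  consider "A \<inter> S \<noteq> {}" "A \<inter> S \<noteq> S" | "A \<inter> S = {}" | "S \<subseteq> A" by blast
  then show "\<exists>a\<in>A. \<exists>b\<in>insert w S - A. E a b"
  proof cases
    case 1
    have "\<exists>p\<in>A \<inter> S. \<exists>q\<in>S - A \<inter> S. E p q"
      using 1 by (intro S[unfolded connected_on_def, rule_format]) auto
    then show ?thesis by blast
  next
    case 2
    then have "w \<in> A" "a \<notin> A" using A a by auto
    then show ?thesis using a w by blast
  next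
    case 3
    then have "w \<notin> A" using A by blast
    then show ?thesis using 3 a by blast
  qed
qed

text \<open>
  As long as the listed vertices do not exhaust \<open>V\<close>, an edge across the cut supplies the next
  one.
\<close>
lemma connected_on_growing_list:
  assumes fin: "finite V" and v: "v \<in> V" and conn: "connected_on E V"
  obtains ws where "growing E ws" "set ws = V" "ws ! 0 = v"
proof -
  have "\<exists>ws. growing E ws \<and> set ws \<subseteq> V \<and> ws ! 0 = v \<and> length ws = Suc m"
    if "m < card V" for m
    using that
  proof (induction m)
    case 0
    show ?case by (rule exI[of _ "[v]"]) (auto simp: growing_def v)
  next
    case (Suc m)
    then obtain ws where ws: "growing E ws" "set ws \<subseteq> V" "ws ! 0 = v" "length ws = Suc m"
      by auto
    then have "card (set ws) = Suc m" by (simp add: growing_def distinct_card)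
    then have "set ws \<noteq> V" "set ws \<noteq> {}" using Suc.prems by auto
    then have "\<exists>a\<in>set ws. \<exists>b\<in>V - set ws. E a b"
      using ws(2) by (intro conn[unfolded connected_on_def, rule_format]) auto
    then obtain a b where ab: "a \<in> set ws" "b \<in> V - set ws" "E a b" by blast
    then obtain j where j: "j < length ws" "ws ! j = a" by (auto simp: in_set_conv_nth)
    have "growing E (ws @ [b])"
      unfolding growing_def
    proof (intro conjI allI impI)
      show "distinct (ws @ [b])" using ws ab by (simp add: growing_def)
      fix k assume k: "k < length (ws @ [b])" "0 < k"
      show "\<exists>j<k. E ((ws @ [b]) ! j) ((ws @ [b]) ! k)"
      proof (cases "k < length ws")
        case True
        then obtain i where "i < k" "E (ws ! i) (ws ! k)"
          using ws(1) k unfolding growing_def by blast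
        then show ?thesis using True by (intro exI[of _ i]) (auto simp: nth_append)
      next
        case False
        then have "k = length ws" using k by simp
        then show ?thesis using j ab by (intro exI[of _ j]) (auto simp: nth_append)
      qed
    qed
    then show ?case using ws ab
      by (intro exI[of _ "ws @ [b]"]) (auto simp: nth_append)
  qed
  moreover have "0 < card V" using fin v by (auto simp: card_gt_0_iff)
  moreover from this have "card V - 1 < card V" by simp
  ultimately have "\<exists>ws. growing E ws \<and> set ws \<subseteq> V \<and> ws ! 0 = v \<and> length ws = Suc (card V - 1)"
    by blast
  then obtain ws where
    ws: "growing E ws" "set ws \<subseteq> V" "ws ! 0 = v" "length ws = card V"
    using \<open>0 < card V\<close> by auto
  then have "card (set ws) = card V" by (simp add: growing_def distinct_card)
  then have "set ws = V" using ws fin by (simp add: card_subset_eq)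
  with ws that show ?thesis by blast
qed

text \<open>
  The Cauchy-Schwarz inequality for paths, in the form needed to append a single edge: if a
  drop \<open>a\<close> over \<open>k\<close> edges of total energy \<open>F\<close> satisfies \<open>a\<^sup>2 \<le> k F\<close>, then so does the drop
  over \<open>k + 1\<close> edges after adding one of drop \<open>b\<close>.
\<close>
lemma power2_sum_le_of_steps:
  fixes a b F :: real
  assumes "a\<^sup>2 \<le> real k * F" "0 \<le> F"
  shows "(a + b)\<^sup>2 \<le> (real k + 1) * (F + b\<^sup>2)"
proof (cases "k = 0")
  case True
  then show ?thesis using assms by simp
next
  case False
  have "(real k + 1) * (a\<^sup>2 + real k * b\<^sup>2) - real k * (a + b)\<^sup>2 = (a - real k * b)\<^sup>2"
    by (simp add: power2_eq_square algebra_simps)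
  then have "real k * (a + b)\<^sup>2 \<le> (real k + 1) * (a\<^sup>2 + real k * b\<^sup>2)"
    by (smt (verit) zero_le_power2)
  also have "\<dots> \<le> (real k + 1) * (real k * F + real k * b\<^sup>2)"
    using assms by (intro mult_left_mono) auto
  also have "\<dots> = real k * ((real k + 1) * (F + b\<^sup>2))" by (simp add: algebra_simps)
  finally show ?thesis using False by simp
qed

text \<open>
  Tracing predecessors from \<open>ws ! k\<close> back to \<open>ws ! 0\<close> gives a path of at most \<open>j + 1\<close> edges
  once the first step goes to \<open>ws ! j\<close>. All edges of the path are distinct because positions
  decrease, so their energies add up to at most the total. The induction adds the edge of
  \<open>ws ! k\<close> to the energy of the preceding prefix, which avoids an explicit path.
\<close>
lemma growing_drop_le_energy:
  assumes grow: "growing E ws" and sym: "symp E"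
    and jk: "j < k" "k < length ws" "E (ws ! j) (ws ! k)"
  shows "(x (ws ! 0) - x (ws ! k))\<^sup>2 \<le> (real j + 1) * energy E (set ws) x"
proof -
  \<comment> \<open>Energy of the first \<open>m\<close> vertices; each new vertex adds at least the energy of one new edge.\<close>
  define F where "F m = energy E (set (take m ws)) x" for m
  have F0: "0 \<le> F m" for m by (simp add: F_def energy_nonneg)
  have Fmono: "F m \<le> F m'" if "m \<le> m'" for m m'
    unfolding F_def using that by (intro energy_mono set_take_subset_set_take) auto
  have step: "F k + (x (ws ! j) - x (ws ! k))\<^sup>2 \<le> F (Suc k)"
    if "j < k" "k < length ws" "E (ws ! j) (ws ! k)" for j k
  proof -
    have "set (take (Suc k) ws) = insert (ws ! k) (set (take k ws))"
      using that by (simp add: take_Suc_conv_app_nth)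
    moreover have "ws ! k \<notin> set (take k ws)"
      using grow that by (auto simp: growing_def in_set_conv_nth nth_eq_iff_index_eq)
    moreover have "ws ! j \<in> set (take k ws)"
      using that by (auto simp: in_set_conv_nth)
    ultimately show ?thesis
      unfolding F_def using energy_insert[of "set (take k ws)" "ws ! k" "ws ! j" E x] that sym
      by (auto dest: sympD)
  qed
  have drop: "(x (ws ! 0) - x (ws ! k))\<^sup>2 \<le> real k * F (Suc k)" if "k < length ws" for k
    using that
  proof (induction k rule: less_induct)
    case (less k)
    show ?case
    proof (cases "k = 0")
      case False
      then obtain j where j: "j < k" "E (ws ! j) (ws ! k)"
        using grow less.prems unfolding growing_def by blast
      have "(x (ws ! 0) - x (ws ! j))\<^sup>2 \<le> real j * F (Suc j)" using less j by simp
      also have "\<dots> \<le> real j * F k" using j by (intro mult_left_mono Fmono) auto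
      finally have "(x (ws ! 0) - x (ws ! j) + (x (ws ! j) - x (ws ! k)))\<^sup>2
          \<le> (real j + 1) * (F k + (x (ws ! j) - x (ws ! k))\<^sup>2)"
        by (intro power2_sum_le_of_steps F0)
      also have "\<dots> \<le> real k * F (Suc k)"
        using j step[OF j(1) less.prems j(2)] F0 by (intro mult_mono) auto
      finally show ?thesis by simp
    qed simp
  qed
  have "(x (ws ! 0) - x (ws ! j))\<^sup>2 \<le> real j * F (Suc j)" using drop jk by simp
  also have "\<dots> \<le> real j * F k" using jk by (intro mult_left_mono Fmono) auto
  finally have "(x (ws ! 0) - x (ws ! j) + (x (ws ! j) - x (ws ! k)))\<^sup>2
      \<le> (real j + 1) * (F k + (x (ws ! j) - x (ws ! k))\<^sup>2)"
    by (intro power2_sum_le_of_steps F0)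
  also have "\<dots> \<le> (real j + 1) * F (length ws)"
    using step[OF jk] Fmono[of "Suc k" "length ws"] jk by (intro mult_left_mono) auto
  finally show ?thesis by (simp add: F_def)
qed

text \<open>
  The set of vertices where \<open>x\<close> takes a fixed value has no edge to its complement.
\<close>
lemma zero_energy_constant:
  assumes fin: "finite V" and conn: "connected_on E V" and 0: "energy E V x = 0"
    and ab: "a \<in> V" "b \<in> V"
  shows "x a = x b"
proof (rule ccontr)
  assume "x a \<noteq> x b"
  let ?A = "{p \<in> V. x p = x a}"
  have "?A \<subseteq> V" "?A \<noteq> {}" "b \<notin> ?A" using ab \<open>x a \<noteq> x b\<close> by auto
  then have "\<exists>p\<in>?A. \<exists>q\<in>V - ?A. E p q"
    using ab(2) by (intro conn[unfolded connected_on_def, rule_format]) auto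
  then obtain p q where pq: "p \<in> ?A" "q \<in> V - ?A" "E p q" by blast
  have "(\<Sum>p\<in>V. \<Sum>q\<in>V. if E p q then (x p - x q)\<^sup>2 else 0) = 0"
    using 0 by (simp add: energy_def)
  then have "\<forall>p\<in>V. (\<Sum>q\<in>V. if E p q then (x p - x q)\<^sup>2 else 0) = 0"
    using fin by (subst (asm) sum_nonneg_eq_0_iff) (auto intro!: sum_nonneg)
  then have "\<forall>q\<in>V. (if E p q then (x p - x q)\<^sup>2 else 0) = 0"
    using fin pq by (subst (asm) sum_nonneg_eq_0_iff) auto
  then show False using pq by auto
qed

section \<open>Finite sums\<close>

lemma sum_sq_diff:
  fixes y :: "nat \<Rightarrow> real"
  shows "(\<Sum>a<n. \<Sum>b<n. (y a - y b)\<^sup>2) = 2 * real n * (\<Sum>a<n. (y a)\<^sup>2) - 2 * (\<Sum>a<n. y a)\<^sup>2"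
proof -
  have "(\<Sum>a<n. \<Sum>b<n. (y a - y b)\<^sup>2)
      = (\<Sum>a<n. \<Sum>b<n. (y a)\<^sup>2 + (y b)\<^sup>2 - 2 * (y a * y b))"
    by (simp add: power2_diff mult.assoc)
  also have "\<dots> = 2 * real n * (\<Sum>a<n. (y a)\<^sup>2) - 2 * (\<Sum>a<n. \<Sum>b<n. y a * y b)"
    by (simp add: sum.distrib sum_subtractf sum_distrib_left mult.assoc)
  also have "(\<Sum>a<n. \<Sum>b<n. y a * y b) = (\<Sum>a<n. y a)\<^sup>2"
    by (simp add: power2_eq_square sum_product)
  finally show ?thesis .
qed

lemma sum_real_lessThan: "(\<Sum>k<m. real k) = real m * (real m - 1) / 2"
  by (induction m) (auto simp: field_simps)

text \<open>
  Twice the Wiener index of the path graph.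
\<close>
lemma sum_abs_diff_lessThan:
  "(\<Sum>i<n. \<Sum>j<n. \<bar>real i - real j\<bar>) = (real n ^ 3 - real n) / 3"
proof (induction n)
  case (Suc n)
  have "(\<Sum>i<n. \<bar>real i - real n\<bar>) = (\<Sum>i<n. real n - real i)" by (intro sum.cong) auto
  moreover have "(\<Sum>i<n. \<bar>real n - real i\<bar>) = (\<Sum>i<n. real n - real i)" by (intro sum.cong) auto
  moreover have "(\<Sum>i<n. real n - real i) = real n * (real n + 1) / 2"
    by (simp add: sum_subtractf sum_real_lessThan field_simps)
  moreover have "(\<Sum>i<Suc n. \<Sum>j<Suc n. \<bar>real i - real j\<bar>) = (\<Sum>i<n. \<Sum>j<n. \<bar>real i - real j\<bar>)
      + (\<Sum>i<n. \<bar>real i - real n\<bar>) + (\<Sum>j<n. \<bar>real n - real j\<bar>)"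
    by (simp add: sum.distrib)
  ultimately have "(\<Sum>i<Suc n. \<Sum>j<Suc n. \<bar>real i - real j\<bar>)
      = (real n ^ 3 - real n) / 3 + real n * (real n + 1)"
    using Suc by simp
  then show ?case by (simp add: power3_eq_cube field_simps)
qed simp

lemma sum_sum_reindex_bij_betw:
  assumes "bij_betw f A B"
  shows "(\<Sum>s\<in>A. \<Sum>t\<in>A. g (f s) (f t)) = (\<Sum>a\<in>B. \<Sum>b\<in>B. g a b)"
proof -
  have "(\<Sum>s\<in>A. \<Sum>t\<in>A. g (f s) (f t)) = (\<Sum>s\<in>A. \<Sum>b\<in>B. g (f s) b)"
    by (intro sum.cong refl sum.reindex_bij_betw assms)
  also have "\<dots> = (\<Sum>a\<in>B. \<Sum>b\<in>B. g a b)"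
    by (rule sum.reindex_bij_betw[OF assms, of "\<lambda>a. \<Sum>b\<in>B. g a b"])
  finally show ?thesis .
qed

section \<open>Eigenbasis of a graph Laplacian\<close>

text \<open>
  A connected graph on \<open>{..<n}\<close> together with an orthonormal eigenbasis \<open>u\<close> of its Laplacian
  and the eigenvalues \<open>e\<close>, not necessarily ordered. The Laplacian enters only through its
  quadratic form: in eigencoordinates the energy is diagonal. Orthonormality is required of
  the rows and of the columns of \<open>u\<close>; both hold for an orthogonal matrix.
\<close>
locale laplacian_eigenbasis =
  fixes n :: nat and E :: "nat \<Rightarrow> nat \<Rightarrow> bool" and e :: "nat \<Rightarrow> real" and u :: "nat \<Rightarrow> nat \<Rightarrow> real"
  assumes n_pos: "0 < n"
    and sym: "symp E"
    and irrefl: "\<not> E a a"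
    and conn: "connected_on E {..<n}"
    and orthonormal: "i < n \<Longrightarrow> j < n \<Longrightarrow> (\<Sum>a<n. u i a * u j a) = (if i = j then 1 else 0)"
    and complete: "a < n \<Longrightarrow> b < n \<Longrightarrow> (\<Sum>i<n. u i a * u i b) = (if a = b then 1 else 0)"
    and energy_eq: "energy E {..<n} (\<lambda>a. \<Sum>i<n. c i * u i a) = (\<Sum>i<n. e i * (c i)\<^sup>2)"
begin

lemma E_sym: "E a b \<Longrightarrow> E b a"
  using sym by (rule sympD)

lemma energy_eigenvector:
  assumes "i < n" shows "energy E {..<n} (u i) = e i"
proof -
  have "energy E {..<n} (u i) = energy E {..<n} (\<lambda>a. \<Sum>j<n. (if j = i then 1 else 0) * u j a)"
    using assms by (simp add: if_distrib[of "\<lambda>c. c * _"] cong: if_cong)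
  also have "\<dots> = (\<Sum>j<n. if j = i then e i else 0)"
    unfolding energy_eq by (intro sum.cong) auto
  finally show ?thesis using assms by simp
qed

lemma e_nonneg: "i < n \<Longrightarrow> 0 \<le> e i"
  using energy_eigenvector energy_nonneg by metis

lemma eigen_expansion:
  assumes "a < n"
  shows "x a = (\<Sum>i<n. (\<Sum>b<n. x b * u i b) * u i a)"
proof -
  have "(\<Sum>i<n. (\<Sum>b<n. x b * u i b) * u i a) = (\<Sum>i<n. \<Sum>b<n. x b * (u i b * u i a))"
    by (simp add: sum_distrib_right mult.assoc)
  also have "\<dots> = (\<Sum>b<n. \<Sum>i<n. x b * (u i b * u i a))" by (rule sum.swap)
  also have "\<dots> = (\<Sum>b<n. x b * (\<Sum>i<n. u i b * u i a))" by (simp add: sum_distrib_left)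
  also have "\<dots> = (\<Sum>b<n. if b = a then x a else 0)"
    using assms by (intro sum.cong) (auto simp: complete)
  finally show ?thesis using assms by simp
qed

lemma energy_expansion:
  "energy E {..<n} x = (\<Sum>i<n. e i * (\<Sum>b<n. x b * u i b)\<^sup>2)"
  unfolding energy_eq[symmetric] by (rule energy_cong) (simp add: eigen_expansion[of _ x])

lemma zero_eigenvector_constant:
  assumes "i < n" "e i = 0" "a < n" "b < n"
  shows "u i a = u i b"
  using zero_energy_constant[OF _ conn, of "u i" a b] energy_eigenvector assms by simp

lemma zero_eigenvector_entry:
  assumes "i < n" "e i = 0" "a < n"
  shows "real n * (u i a)\<^sup>2 = 1"
proof -
  have "(\<Sum>b<n. u i b * u i b) = (\<Sum>b<n. (u i a)\<^sup>2)"
    by (intro sum.cong refl)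
      (metis assms lessThan_iff power2_eq_square zero_eigenvector_constant)
  then show ?thesis using orthonormal[of i i] assms by simp
qed

text \<open>
  The constant function has energy zero, so not all eigenvalues are positive. Conversely a
  zero eigenvector is constant, and two nonzero constants are never orthogonal.
\<close>
lemma unique_zero_eigenvalue: "\<exists>!i. i < n \<and> e i = 0"
proof (rule ex_ex1I)
  show "\<exists>i. i < n \<and> e i = 0"
  proof (rule ccontr)
    assume nz: "\<nexists>i. i < n \<and> e i = 0"
    let ?c = "\<lambda>i. \<Sum>b<n. 1 * u i b"
    have "energy E {..<n} (\<lambda>_. 1) = 0" by (simp add: energy_def cong: if_cong)
    then have "(\<Sum>i<n. e i * (?c i)\<^sup>2) = 0" using energy_expansion[of "\<lambda>_. 1"] by simp
    then have "\<forall>i<n. e i * (?c i)\<^sup>2 = 0"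
      using e_nonneg by (subst (asm) sum_nonneg_eq_0_iff) auto
    then have "\<forall>i<n. ?c i = 0" using nz by auto
    then show False using eigen_expansion[OF n_pos, of "\<lambda>_. 1"] by simp
  qed
  fix i j assume i: "i < n \<and> e i = 0" and j: "j < n \<and> e j = 0"
  show "i = j"
  proof (rule ccontr)
    assume "i \<noteq> j"
    have "(\<Sum>b<n. u i b * u j b) = (\<Sum>b<n. u i 0 * u j 0)"
      by (intro sum.cong refl)
        (metis i j n_pos lessThan_iff zero_eigenvector_constant)
    then have "real n * (u i 0 * u j 0) = 0" using orthonormal[of i j] i j \<open>i \<noteq> j\<close> by simp
    then have "u i 0 = 0 \<or> u j 0 = 0" using n_pos by simp
    then show False
      using zero_eigenvector_entry[of i 0] zero_eigenvector_entry[of j 0] i j n_pos by auto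
  qed
qed

text \<open>
  Orthogonality to the constant eigenvector of the eigenvalue zero.
\<close>
lemma sum_eigenvector_zero:
  assumes "i < n" "e i \<noteq> 0"
  shows "(\<Sum>a<n. u i a) = 0"
proof -
  obtain z where z: "z < n" "e z = 0" using unique_zero_eigenvalue by blast
  have "(\<Sum>a<n. u i a * u z a) = (\<Sum>a<n. u i a * u z 0)"
    by (intro sum.cong refl) (metis z n_pos lessThan_iff zero_eigenvector_constant)
  moreover have "i \<noteq> z" using assms z by blast
  ultimately have "(\<Sum>a<n. u i a) * u z 0 = 0"
    using orthonormal[of i z] assms z by (simp add: sum_distrib_right)
  moreover have "u z 0 \<noteq> 0" using zero_eigenvector_entry[of z 0] z n_pos by auto
  ultimately show ?thesis by simp
qed

lemma sum_sq_diff_eigenvector: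
  assumes "i < n" "e i \<noteq> 0"
  shows "(\<Sum>a<n. \<Sum>b<n. (u i a - u i b)\<^sup>2) = 2 * real n"
proof -
  have "(\<Sum>a<n. (u i a)\<^sup>2) = 1"
    using orthonormal[of i i] assms by (simp add: power2_eq_square)
  then show ?thesis using assms by (simp add: sum_sq_diff sum_eigenvector_zero)
qed

subsection \<open>Lower bound and complete graphs\<close>

text \<open>
  Because \<open>inverse 0 = 0\<close>, the zero eigenvalue contributes nothing, and the sum may run over
  all indices.
\<close>
definition sum_inverse :: real where
  "sum_inverse = (\<Sum>i<n. inverse (e i))"

text \<open>
  The trace of the Laplacian, computed from the energies of the eigenvectors: by completeness
  each edge contributes \<open>\<Sum>\<^sub>i (u\<^sub>i(a) - u\<^sub>i(b))\<^sup>2 = 2\<close>.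
\<close>
lemma sum_eigenvalues: "(\<Sum>i<n. e i) = real (card {(a, b). a < n \<and> b < n \<and> E a b})"
proof -
  have "(\<Sum>i<n. e i) = (\<Sum>i<n. \<Sum>a<n. \<Sum>b<n. (if E a b then (u i a - u i b)\<^sup>2 else 0) / 2)"
    by (intro sum.cong refl) (simp add: energy_eigenvector[symmetric] energy_def sum_divide_distrib)
  also have "\<dots> = (\<Sum>a<n. \<Sum>i<n. \<Sum>b<n. (if E a b then (u i a - u i b)\<^sup>2 else 0) / 2)"
    by (rule sum.swap)
  also have "\<dots> = (\<Sum>a<n. \<Sum>b<n. \<Sum>i<n. (if E a b then (u i a - u i b)\<^sup>2 else 0) / 2)"
    by (intro sum.cong refl sum.swap)
  also have "\<dots> = (\<Sum>a<n. \<Sum>b<n. if E a b then 1 else 0)"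
  proof (intro sum.cong refl)
    fix a b assume ab: "a \<in> {..<n}" "b \<in> {..<n}"
    show "(\<Sum>i<n. (if E a b then (u i a - u i b)\<^sup>2 else 0) / 2) = (if E a b then 1 else 0)"
    proof (cases "E a b")
      case True
      then have "a \<noteq> b" using irrefl by blast
      have "(\<Sum>i<n. (u i a - u i b)\<^sup>2)
          = (\<Sum>i<n. u i a * u i a) + (\<Sum>i<n. u i b * u i b) - 2 * (\<Sum>i<n. u i a * u i b)"
        by (simp add: power2_eq_square algebra_simps sum.distrib sum_subtractf sum_distrib_left)
      also have "\<dots> = 2" using ab \<open>a \<noteq> b\<close> by (simp add: complete)
      finally show ?thesis using True by (simp add: sum_divide_distrib[symmetric])
    qed simp
  qed
  also have "\<dots> = (\<Sum>(a, b)\<in>{..<n} \<times> {..<n}. if E a b then 1 else 0)"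
    by (simp add: sum.cartesian_product)
  also have "\<dots> = real (card (({..<n} \<times> {..<n}) \<inter> {(a, b). E a b}))"
    by (simp add: case_prod_unfold sum.If_cases)
  also have "({..<n} \<times> {..<n}) \<inter> {(a, b). E a b} = {(a, b). a < n \<and> b < n \<and> E a b}" by auto
  finally show ?thesis .
qed

lemma card_off_diagonal: "card {(a, b). a < n \<and> b < n \<and> a \<noteq> b} = n * (n - 1)"
proof -
  have "{(a, b). a < n \<and> b < n \<and> a \<noteq> b} = (SIGMA a:{..<n}. {..<n} - {a})" by auto
  then show ?thesis by simp
qed

text \<open>
  The convex function \<open>1 / t\<close> lies above its tangent \<open>2 / n - t / n\<^sup>2\<close> at \<open>t = n\<close>, which is
  the common value of the nonzero eigenvalues of the complete graph. Summing this over the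
  \<open>n - 1\<close> nonzero eigenvalues brings in the trace.
\<close>
lemma sum_inverse_ge_edges:
  "2 * ((real n - 1) / real n) - real (card {(a, b). a < n \<and> b < n \<and> E a b}) / (real n)\<^sup>2
    \<le> sum_inverse"
proof -
  obtain z where z: "z < n" "e z = 0" and uniq: "\<And>i. i < n \<Longrightarrow> e i = 0 \<Longrightarrow> i = z"
    using unique_zero_eigenvalue by blast
  have "2 * (real n - 1) / real n - (\<Sum>i<n. e i) / (real n)\<^sup>2
      = (\<Sum>i\<in>{..<n} - {z}. 2 / real n - e i / (real n)\<^sup>2)"
    using z n_pos by (simp add: sum_subtractf sum_divide_distrib[symmetric] sum.remove[of _ z e] of_nat_diff)
  also have "\<dots> \<le> (\<Sum>i\<in>{..<n} - {z}. inverse (e i))"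
  proof (rule sum_mono)
    fix i assume i: "i \<in> {..<n} - {z}"
    then have pos: "0 < e i" using e_nonneg[of i] uniq[of i] by fastforce
    have "inverse (e i) - (2 / real n - e i / (real n)\<^sup>2) = (e i - real n)\<^sup>2 / (e i * (real n)\<^sup>2)"
      using pos n_pos by (simp add: power2_eq_square field_simps)
    also have "\<dots> \<ge> 0" using pos by simp
    finally show "2 / real n - e i / (real n)\<^sup>2 \<le> inverse (e i)" by simp
  qed
  also have "\<dots> = sum_inverse"
    unfolding sum_inverse_def using z by (simp add: sum.remove[of "{..<n}" z])
  finally show ?thesis by (simp only: sum_eigenvalues times_divide_eq_right)
qed

lemma card_edges_le: "card {(a, b). a < n \<and> b < n \<and> E a b} \<le> n * (n - 1)"
  unfolding card_off_diagonal[symmetric]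
  by (rule card_mono, rule finite_subset[of _ "{..<n} \<times> {..<n}"]) (use irrefl in auto)

theorem sum_inverse_lower: "(real n - 1) / real n \<le> sum_inverse"
proof -
  let ?m = "card {(a, b). a < n \<and> b < n \<and> E a b}"
  have "real ?m \<le> real (n * (n - 1))"
    using card_edges_le of_nat_le_iff by blast
  also have "\<dots> = real n * (real n - 1)" using n_pos by (simp add: of_nat_diff)
  finally have "real ?m / (real n)\<^sup>2 \<le> (real n * (real n - 1)) / (real n)\<^sup>2"
    by (intro divide_right_mono) auto
  also have "\<dots> = (real n - 1) / real n" using n_pos by (simp add: power2_eq_square)
  finally show ?thesis using sum_inverse_ge_edges by linarith
qed

text \<open>
  Equality forces the maximal number of edges. For the complete graph the energy runs over all
  pairs, so every eigenvector orthogonal to the constants has eigenvalue \<open>n\<close>.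
\<close>
theorem sum_inverse_lower_eq_iff:
  "sum_inverse = (real n - 1) / real n \<longleftrightarrow> (\<forall>a<n. \<forall>b<n. a \<noteq> b \<longrightarrow> E a b)"
proof
  assume eq: "sum_inverse = (real n - 1) / real n"
  let ?A = "{(a, b). a < n \<and> b < n \<and> E a b}"
  let ?B = "{(a, b). a < n \<and> b < n \<and> a \<noteq> b}"
  have "(real n - 1) / real n \<le> real (card ?A) / (real n)\<^sup>2"
    using sum_inverse_ge_edges eq by linarith
  then have "(real n)\<^sup>2 * ((real n - 1) / real n) \<le> (real n)\<^sup>2 * (real (card ?A) / (real n)\<^sup>2)"
    by (rule mult_left_mono) simp
  then have "real n * (real n - 1) \<le> real (card ?A)"
    using n_pos by (simp add: power2_eq_square)
  then have "real (n * (n - 1)) \<le> real (card ?A)" using n_pos by (simp add: of_nat_diff)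
  then have le: "card ?B \<le> card ?A" by (simp only: card_off_diagonal of_nat_le_iff)
  have fin: "finite ?B" by (rule finite_subset[of _ "{..<n} \<times> {..<n}"]) auto
  have sub: "?A \<subseteq> ?B" using irrefl by auto
  have "?A = ?B" by (rule card_seteq[OF fin sub le])
  then show "\<forall>a<n. \<forall>b<n. a \<noteq> b \<longrightarrow> E a b" by blast
next
  assume compl: "\<forall>a<n. \<forall>b<n. a \<noteq> b \<longrightarrow> E a b"
  obtain z where z: "z < n" "e z = 0" and uniq: "\<And>i. i < n \<Longrightarrow> e i = 0 \<Longrightarrow> i = z"
    using unique_zero_eigenvalue by blast
  have "e i = real n" if "i < n" "i \<noteq> z" for i
  proof -
    have "e i = (\<Sum>a<n. \<Sum>b<n. (u i a - u i b)\<^sup>2) / 2"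
      unfolding energy_eigenvector[OF that(1), symmetric] energy_def
      by (intro arg_cong2[of _ _ _ _ "(/)"] sum.cong refl) (use compl in auto)
    moreover have "e i \<noteq> 0" using that uniq by blast
    ultimately show ?thesis using sum_sq_diff_eigenvector[of i] that by simp
  qed
  then have "sum_inverse = (\<Sum>i\<in>{..<n} - {z}. inverse (real n))"
    unfolding sum_inverse_def using z by (subst sum.remove[of _ z]) auto
  then show "sum_inverse = (real n - 1) / real n"
    using z n_pos by (simp add: of_nat_diff field_simps)
qed

subsection \<open>Effective resistance\<close>

text \<open>
  The effective resistance between \<open>a\<close> and \<open>b\<close> when every edge is a unit resistor, that is
  \<open>(1\<^sub>a - 1\<^sub>b)\<^sup>T L\<^sup>+ (1\<^sub>a - 1\<^sub>b)\<close> with the pseudoinverse \<open>L\<^sup>+\<close> of the Laplacian, in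
  eigencoordinates.
\<close>
definition resistance :: "nat \<Rightarrow> nat \<Rightarrow> real" where
  "resistance a b = (\<Sum>i<n. (u i a - u i b)\<^sup>2 / e i)"

lemma resistance_nonneg: "0 \<le> resistance a b"
  unfolding resistance_def using e_nonneg by (intro sum_nonneg) auto

lemma resistance_self [simp]: "resistance a a = 0"
  by (simp add: resistance_def)

lemma resistance_commute: "resistance a b = resistance b a"
  by (simp add: resistance_def power2_commute)

text \<open>
  The Kirchhoff index formula: each nonconstant unit eigenvector has
  \<open>\<Sum>\<^sub>a\<^sub>b (u(a) - u(b))\<^sup>2 = 2 n\<close>.
\<close>
lemma sum_resistance: "(\<Sum>a<n. \<Sum>b<n. resistance a b) = 2 * real n * sum_inverse"
proof -
  have "(\<Sum>a<n. \<Sum>b<n. resistance a b) = (\<Sum>a<n. \<Sum>i<n. \<Sum>b<n. (u i a - u i b)\<^sup>2 / e i)"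
    unfolding resistance_def by (intro sum.cong refl sum.swap)
  also have "\<dots> = (\<Sum>i<n. \<Sum>a<n. \<Sum>b<n. (u i a - u i b)\<^sup>2 / e i)" by (rule sum.swap)
  also have "\<dots> = (\<Sum>i<n. 2 * real n * inverse (e i))"
  proof (intro sum.cong refl)
    fix i assume "i \<in> {..<n}"
    moreover have "(\<Sum>a<n. \<Sum>b<n. (u i a - u i b)\<^sup>2 / e i) = (\<Sum>a<n. \<Sum>b<n. (u i a - u i b)\<^sup>2) / e i"
      by (simp add: sum_divide_distrib)
    ultimately show "(\<Sum>a<n. \<Sum>b<n. (u i a - u i b)\<^sup>2 / e i) = 2 * real n * inverse (e i)"
      using sum_sq_diff_eigenvector[of i] by (cases "e i = 0") (simp_all add: divide_inverse)
  qed
  finally show ?thesis by (simp add: sum_inverse_def sum_distrib_left)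
qed

text \<open>
  Dual description of the resistance, used for lower bounds: any test function \<open>x\<close> bounds it
  from below. In eigencoordinates this is the inequality \<open>2 c d \<le> d\<^sup>2 / e + e c\<^sup>2\<close> term by
  term.
\<close>
lemma drop_le_resistance_energy:
  assumes "a < n" "b < n"
  shows "2 * (x a - x b) \<le> resistance a b + energy E {..<n} x"
proof -
  let ?c = "\<lambda>i. \<Sum>p<n. x p * u i p"
  have "2 * (x a - x b) = (\<Sum>i<n. 2 * (?c i * (u i a - u i b)))"
    by (subst eigen_expansion[OF assms(1), of x], subst eigen_expansion[OF assms(2), of x])
      (simp add: sum_subtractf right_diff_distrib sum_distrib_left)
  also have "\<dots> \<le> (\<Sum>i<n. (u i a - u i b)\<^sup>2 / e i + e i * (?c i)\<^sup>2)"
  proof (rule sum_mono)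
    fix i assume i: "i \<in> {..<n}"
    show "2 * (?c i * (u i a - u i b)) \<le> (u i a - u i b)\<^sup>2 / e i + e i * (?c i)\<^sup>2"
    proof (cases "e i = 0")
      case True
      then show ?thesis using zero_eigenvector_constant[of i a b] i assms by simp
    next
      case False
      then have pos: "0 < e i" using e_nonneg[of i] i by simp
      have "(u i a - u i b)\<^sup>2 / e i + e i * (?c i)\<^sup>2 - 2 * (?c i * (u i a - u i b))
          = (u i a - u i b - e i * ?c i)\<^sup>2 / e i"
        using pos by (simp add: power2_diff power_mult_distrib field_simps power2_eq_square)
      also have "\<dots> \<ge> 0" using pos by simp
      finally show ?thesis by simp
    qed
  qed
  also have "\<dots> = resistance a b + energy E {..<n} x"
    by (simp add: sum.distrib resistance_def energy_expansion)
  finally show ?thesis .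
qed

text \<open>
  The witness is the potential \<open>L\<^sup>+ (1\<^sub>a - 1\<^sub>b)\<close> of a unit current from \<open>a\<close> to \<open>b\<close>.
\<close>
lemma resistance_potential:
  assumes "a < n" "b < n"
  obtains x where "x a - x b = resistance a b" "energy E {..<n} x = resistance a b"
proof
  let ?c = "\<lambda>i. (u i a - u i b) / e i"
  let ?x = "\<lambda>p. \<Sum>i<n. ?c i * u i p"
  have "?x a - ?x b = (\<Sum>i<n. ?c i * (u i a - u i b))"
    by (simp add: sum_subtractf right_diff_distrib)
  then show "?x a - ?x b = resistance a b" by (simp add: resistance_def power2_eq_square)
  show "energy E {..<n} ?x = resistance a b"
    unfolding energy_eq resistance_def
    by (intro sum.cong refl) (auto simp: power2_eq_square)
qed

subsection \<open>Upper bound\<close>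

text \<open>
  Resistance is at most path length: for the potential of the unit current, the drop and the
  energy are both the resistance \<open>r\<close>, so the bound on drops reads \<open>r\<^sup>2 \<le> (j + 1) r\<close>.
\<close>
lemma resistance_growing_le:
  assumes grow: "growing E ws" and ws: "set ws \<subseteq> {..<n}"
    and jk: "j < k" "k < length ws" "E (ws ! j) (ws ! k)"
  shows "resistance (ws ! 0) (ws ! k) \<le> real j + 1"
proof -
  have "ws ! 0 \<in> set ws" "ws ! k \<in> set ws" using jk by (auto intro: nth_mem)
  then have "ws ! 0 < n" "ws ! k < n" using ws by auto
  then obtain x where x: "x (ws ! 0) - x (ws ! k) = resistance (ws ! 0) (ws ! k)"
    "energy E {..<n} x = resistance (ws ! 0) (ws ! k)"
    by (rule resistance_potential)
  let ?r = "resistance (ws ! 0) (ws ! k)"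
  have "?r\<^sup>2 \<le> (real j + 1) * energy E (set ws) x"
    using growing_drop_le_energy[OF grow sym jk, of x] x by simp
  also have "\<dots> \<le> (real j + 1) * ?r"
    using energy_mono[of "{..<n}" "set ws" E x] ws x by (intro mult_left_mono) auto
  finally have "?r * ?r \<le> (real j + 1) * ?r" by (simp add: power2_eq_square)
  then show ?thesis using resistance_nonneg[of "ws ! 0" "ws ! k"]
    by (cases "?r = 0") auto
qed

lemma resistance_growing_le_index:
  assumes grow: "growing E ws" and ws: "set ws \<subseteq> {..<n}" and k: "k < length ws"
  shows "resistance (ws ! 0) (ws ! k) \<le> real k"
proof (cases "k = 0")
  case False
  then obtain j where j: "j < k" "E (ws ! j) (ws ! k)" using grow k unfolding growing_def by blast
  then have "resistance (ws ! 0) (ws ! k) \<le> real j + 1"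
    by (intro resistance_growing_le assms)
  also have "\<dots> \<le> real k" using j by simp
  finally show ?thesis .
qed simp

lemma sum_growing_nth:
  assumes "growing E ws"
  shows "(\<Sum>b\<in>set ws. g b) = (\<Sum>k<length ws. g (ws ! k))"
  using assms by (metis bij_betw_nth growing_def sum.reindex_bij_betw)

text \<open>
  Seen from any vertex of a connected set, the resistances to the others are at most
  \<open>0, 1, 2, \<dots>\<close> in an order of discovery.
\<close>
lemma sum_resistance_from_le:
  assumes "S \<subseteq> {..<n}" "connected_on E S" "v \<in> S"
  shows "(\<Sum>b\<in>S. resistance v b) \<le> real (card S) * (real (card S) - 1) / 2"
proof -
  obtain ws where ws: "growing E ws" "set ws = S" "ws ! 0 = v"
    using connected_on_growing_list[of S v E] assms finite_subset[of S] by blast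
  have len: "length ws = card S" using ws by (metis distinct_card growing_def)
  have "(\<Sum>b\<in>S. resistance v b) = (\<Sum>k<card S. resistance v (ws ! k))"
    using sum_growing_nth[OF ws(1)] ws len by metis
  also have "\<dots> \<le> (\<Sum>k<card S. real k)"
    using resistance_growing_le_index[OF ws(1)] ws assms len by (intro sum_mono) auto
  finally show ?thesis by (simp add: sum_real_lessThan)
qed

lemma sum_resistance_insert:
  assumes "finite S" "w \<notin> S"
  shows "(\<Sum>a\<in>insert w S. \<Sum>b\<in>insert w S. resistance a b)
    = (\<Sum>a\<in>S. \<Sum>b\<in>S. resistance a b) + 2 * (\<Sum>b\<in>insert w S. resistance w b)"
proof -
  have "(\<Sum>a\<in>S. resistance a w) = (\<Sum>a\<in>S. resistance w a)"
    by (intro sum.cong refl resistance_commute)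
  then show ?thesis using assms by (simp add: sum.distrib)
qed

lemma connected_extend:
  assumes "S \<subseteq> {..<n}" "S \<noteq> {}" "S \<noteq> {..<n}" "connected_on E S"
  obtains w where "w < n" "w \<notin> S" "connected_on E (insert w S)"
proof -
  have "\<exists>a\<in>S. \<exists>b\<in>{..<n} - S. E a b"
    using assms by (intro conn[unfolded connected_on_def, rule_format]) auto
  then obtain a w where "a \<in> S" "w \<in> {..<n} - S" "E a w" by blast
  then show ?thesis using that connected_on_insert[OF assms(4)] E_sym by blast
qed

text \<open>
  Grows a connected set vertex by vertex. A new vertex that brings the size to \<open>k\<close> adds at
  most \<open>k (k - 1)\<close> to the sum over ordered pairs, as it would when a path is prolonged at its
  end.
\<close>
lemma connected_subset_sum_resistance:
  assumes "m < n"
  shows "\<exists>S\<subseteq>{..<n}. card S = Suc m \<and> connected_on E S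
    \<and> (\<Sum>a\<in>S. \<Sum>b\<in>S. resistance a b) \<le> (real (Suc m) ^ 3 - real (Suc m)) / 3"
  using assms
proof (induction m)
  case 0
  then show ?case by (intro exI[of _ "{0}"]) (auto simp: connected_on_def)
next
  case (Suc m)
  then obtain S where S: "S \<subseteq> {..<n}" "card S = Suc m" "connected_on E S"
    and le: "(\<Sum>a\<in>S. \<Sum>b\<in>S. resistance a b) \<le> (real (Suc m) ^ 3 - real (Suc m)) / 3"
    by auto
  have "S \<noteq> {}" "S \<noteq> {..<n}" using S Suc.prems by auto
  then obtain w where w: "w < n" "w \<notin> S" "connected_on E (insert w S)"
    using connected_extend S by blast
  have fin: "finite S" using S finite_subset by blast
  have card: "card (insert w S) = Suc (Suc m)" using S w fin by simp
  have from_w: "(\<Sum>b\<in>insert w S. resistance w b) \<le> real (Suc (Suc m)) * (real (Suc (Suc m)) - 1) / 2"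
    using sum_resistance_from_le[of "insert w S" w] w S card by simp
  have "(\<Sum>a\<in>insert w S. \<Sum>b\<in>insert w S. resistance a b)
      \<le> (real (Suc m) ^ 3 - real (Suc m)) / 3 + real (Suc (Suc m)) * (real (Suc (Suc m)) - 1)"
    unfolding sum_resistance_insert[OF fin w(2)] using le from_w by linarith
  also have "\<dots> = (real (Suc (Suc m)) ^ 3 - real (Suc (Suc m))) / 3"
    by (simp add: power3_eq_cube field_simps)
  finally show ?case using S w card by (intro exI[of _ "insert w S"]) auto
qed

theorem sum_inverse_upper: "sum_inverse \<le> ((real n)\<^sup>2 - 1) / 6"
proof -
  obtain S where S: "S \<subseteq> {..<n}" "card S = n"
    "(\<Sum>a\<in>S. \<Sum>b\<in>S. resistance a b) \<le> (real n ^ 3 - real n) / 3"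
    using connected_subset_sum_resistance[of "n - 1"] n_pos by auto
  then have "S = {..<n}" by (simp add: card_subset_eq)
  then have "2 * real n * sum_inverse \<le> (real n ^ 3 - real n) / 3"
    using S sum_resistance by simp
  also have "\<dots> = 2 * real n * (((real n)\<^sup>2 - 1) / 6)"
    by (simp add: power3_eq_cube power2_eq_square field_simps)
  finally show ?thesis using n_pos by simp
qed

subsection \<open>Path graphs\<close>

definition path_labelling :: "(nat \<Rightarrow> nat) \<Rightarrow> bool" where
  "path_labelling f \<longleftrightarrow> bij_betw f {..<n} {..<n}
     \<and> (\<forall>i<n. \<forall>j<n. E (f i) (f j) \<longleftrightarrow> j = Suc i \<or> i = Suc j)"

text \<open>
  In an order of discovery from \<open>w\<close>, the vertex at position \<open>k\<close> must be at resistance exactly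
  \<open>k\<close>. An edge to an earlier position \<open>j\<close> limits this resistance to \<open>j + 1\<close>, so only
  \<open>j = k - 1\<close> is possible.
\<close>
lemma path_labelling_if_extremal:
  assumes w: "w < n" and ext: "real n * (real n - 1) / 2 \<le> (\<Sum>b<n. resistance w b)"
  shows "\<exists>f. path_labelling f"
proof -
  obtain ws where ws: "growing E ws" "set ws = {..<n}" "ws ! 0 = w"
    using connected_on_growing_list[of "{..<n}" w E] w conn by auto
  have dist: "distinct ws" using ws by (simp add: growing_def)
  have len: "length ws = n" using dist ws by (metis card_lessThan distinct_card)
  have le: "resistance w (ws ! k) \<le> real k" if "k < n" for k
    using resistance_growing_le_index[OF ws(1), of k] ws len that by simp
  have "(\<Sum>b<n. resistance w b) = (\<Sum>k<n. resistance w (ws ! k))"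
    using sum_growing_nth[OF ws(1)] ws len by metis
  then have "(\<Sum>k<n. real k - resistance w (ws ! k)) \<le> 0"
    using ext by (simp add: sum_subtractf sum_real_lessThan)
  moreover have "(\<Sum>k<n. real k - resistance w (ws ! k)) \<ge> 0"
    using le by (intro sum_nonneg) auto
  ultimately have "(\<Sum>k<n. real k - resistance w (ws ! k)) = 0" by simp
  \<comment> \<open>The slacks in the bounds by position are nonnegative and sum to zero.\<close>
  then have eq: "resistance w (ws ! k) = real k" if "k < n" for k
    using le that by (subst (asm) sum_nonneg_eq_0_iff) auto
  have consec: "k = Suc j" if "j < k" "k < n" "E (ws ! j) (ws ! k)" for j k
  proof -
    have "resistance (ws ! 0) (ws ! k) \<le> real j + 1"
      using that ws len by (intro resistance_growing_le) auto
    then show ?thesis using eq[of k] ws that by simp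
  qed
  have edge: "E (ws ! j) (ws ! Suc j)" if "Suc j < n" for j
  proof -
    have "\<exists>i<Suc j. E (ws ! i) (ws ! Suc j)"
      using ws(1) len that unfolding growing_def by simp
    then obtain i where "i < Suc j" "E (ws ! i) (ws ! Suc j)" by blast
    then show ?thesis using consec[of i "Suc j"] that by simp
  qed
  have "E (ws ! i) (ws ! j) \<longleftrightarrow> j = Suc i \<or> i = Suc j" if "i < n" "j < n" for i j
    using consec[of i j] consec[of j i] edge[of i] edge[of j] that irrefl E_sym
    by (metis linorder_neqE_nat)
  moreover have "bij_betw (\<lambda>i. ws ! i) {..<n} {..<n}"
    using bij_betw_nth[OF dist] ws len by simp
  ultimately show ?thesis unfolding path_labelling_def by blast
qed

lemma sum_path_edges:
  fixes g :: "nat \<Rightarrow> nat \<Rightarrow> real"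
  assumes "\<And>s t. g s t = g t s"
  shows "(\<Sum>s<n. \<Sum>t<n. if t = Suc s \<or> s = Suc t then g s t else 0) = 2 * (\<Sum>s<n - 1. g s (Suc s))"
proof -
  have "(\<Sum>s<n. \<Sum>t<n. if t = Suc s \<or> s = Suc t then g s t else 0)
      = (\<Sum>s<n. \<Sum>t<n. (if t = Suc s then g s t else 0) + (if s = Suc t then g s t else 0))"
    by (intro sum.cong refl) auto
  also have "\<dots> = (\<Sum>s<n. \<Sum>t<n. if t = Suc s then g s t else 0)
      + (\<Sum>s<n. \<Sum>t<n. if s = Suc t then g s t else 0)"
    by (simp add: sum.distrib)
  also have "(\<Sum>s<n. \<Sum>t<n. if s = Suc t then g s t else 0)
      = (\<Sum>t<n. \<Sum>s<n. if s = Suc t then g s t else 0)"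
    by (rule sum.swap)
  also have "\<dots> = (\<Sum>s<n. \<Sum>t<n. if t = Suc s then g s t else 0)"
    by (intro sum.cong refl) (auto intro: assms)
  also have "(\<Sum>s<n. \<Sum>t<n. if t = Suc s then g s t else 0) = (\<Sum>s<n. if Suc s < n then g s (Suc s) else 0)"
    by (intro sum.cong refl) (simp add: sum.delta)
  also have "\<dots> = (\<Sum>s<n - 1. g s (Suc s))"
    using n_pos by (intro sum.mono_neutral_cong_right) auto
  finally show ?thesis by simp
qed

text \<open>
  On a path the resistance is at least the distance. The test function falls by one on each
  edge between positions \<open>i\<close> and \<open>j\<close> and is constant elsewhere, so its energy and its drop are
  both \<open>j - i\<close>.
\<close>
lemma path_resistance_ge:
  assumes f: "path_labelling f" and ij: "i \<le> j" "j < n"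
  shows "real j - real i \<le> resistance (f i) (f j)"
proof -
  have bij: "bij_betw f {..<n} {..<n}" using f by (simp add: path_labelling_def)
  \<comment> \<open>Positions clamped to the interval from \<open>i\<close> to \<open>j\<close>, negated so that the drop is positive.\<close>
  define y where "y t = - real (min (max t i) j)" for t
  define x where "x = y \<circ> the_inv_into {..<n} f"
  have xf: "x (f t) = y t" if "t < n" for t
    using bij that by (simp add: x_def the_inv_into_f_f bij_betw_def)
  have "energy E {..<n} x
      = (\<Sum>s<n. \<Sum>t<n. if E (f s) (f t) then (x (f s) - x (f t))\<^sup>2 else 0) / 2"
    unfolding energy_def
    by (simp only: sum_sum_reindex_bij_betw[OF bij, of "\<lambda>a b. if E a b then (x a - x b)\<^sup>2 else 0"])
  also have "\<dots> = (\<Sum>s<n. \<Sum>t<n. if t = Suc s \<or> s = Suc t then (y s - y t)\<^sup>2 else 0) / 2"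
    using f by (intro arg_cong2[of _ _ _ _ "(/)"] sum.cong refl) (auto simp: xf path_labelling_def)
  also have "\<dots> = (\<Sum>s<n - 1. (y s - y (Suc s))\<^sup>2)"
    by (subst sum_path_edges) (auto simp: power2_commute)
  also have "\<dots> = (\<Sum>s<n - 1. y s - y (Suc s))"
  proof (intro sum.cong refl)
    fix s
    have "y s - y (Suc s) = (if i \<le> s \<and> s < j then 1 else 0)"
    proof (cases "i \<le> s \<and> s < j")
      case False
      then have "min (max s i) j = min (max (Suc s) i) j" using ij(1) by auto
      then show ?thesis using False by (simp add: y_def)
    qed (simp add: y_def)
    then show "(y s - y (Suc s))\<^sup>2 = y s - y (Suc s)" by simp
  qed
  also have "\<dots> = y 0 - y (n - 1)" by (rule sum_lessThan_telescope')
  also have "\<dots> = real j - real i"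
  proof -
    have "min (max (n - 1) i) j = j" using ij by auto
    then show ?thesis using ij by (simp add: y_def)
  qed
  finally have "energy E {..<n} x = real j - real i" .
  moreover have "x (f i) - x (f j) = real j - real i"
    using ij by (simp add: xf y_def)
  moreover have "f i < n" "f j < n" using bij ij by (auto dest: bij_betwE)
  ultimately show ?thesis
    using drop_le_resistance_energy[of "f i" "f j" x] by simp
qed

text \<open>
  If the bound is attained, the last vertex added to a connected set of \<open>n - 1\<close> vertices has
  maximal total resistance, and the graph is a path. On a path the resistances are at least
  the distances, whose sum gives the bound.
\<close>
theorem sum_inverse_upper_eq_iff:
  "sum_inverse = ((real n)\<^sup>2 - 1) / 6 \<longleftrightarrow> (\<exists>f. path_labelling f)"
proof
  assume eq: "sum_inverse = ((real n)\<^sup>2 - 1) / 6"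
  \<comment> \<open>A single vertex is not obtained by extending a nonempty set.\<close>
  show "\<exists>f. path_labelling f"
  proof (cases "n = 1")
    case True
    then show ?thesis
      unfolding path_labelling_def by (intro exI[of _ id]) (auto simp: irrefl)
  next
    case False
    then obtain m where m: "n = Suc (Suc m)" using n_pos by (metis One_nat_def not0_implies_Suc gr_implies_not0)
    then obtain S where S: "S \<subseteq> {..<n}" "card S = Suc m" "connected_on E S"
      and le: "(\<Sum>a\<in>S. \<Sum>b\<in>S. resistance a b) \<le> (real (Suc m) ^ 3 - real (Suc m)) / 3"
      using connected_subset_sum_resistance[of m] by auto
    have "S \<noteq> {}" "S \<noteq> {..<n}" using S m by auto
    then obtain w where w: "w < n" "w \<notin> S" using connected_extend S by blast
    have fin: "finite S" using S finite_subset by blast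
    have "insert w S = {..<n}"
      using S w fin m by (intro card_subset_eq) auto
    then have "2 * real n * sum_inverse
        = (\<Sum>a\<in>S. \<Sum>b\<in>S. resistance a b) + 2 * (\<Sum>b<n. resistance w b)"
      using sum_resistance_insert[OF fin w(2)] sum_resistance by simp
    moreover have "2 * real n * sum_inverse
        = (real (Suc m) ^ 3 - real (Suc m)) / 3 + real n * (real n - 1)"
    proof -
      have Suc_m: "real (Suc m) = real n - 1" using m by simp
      show ?thesis
        unfolding eq Suc_m by (simp add: power3_eq_cube power2_eq_square field_simps)
    qed
    ultimately have "real n * (real n - 1) / 2 \<le> (\<Sum>b<n. resistance w b)" using le by linarith
    then show ?thesis by (rule path_labelling_if_extremal[OF w(1)])
  qed
next
  assume "\<exists>f. path_labelling f"
  then obtain f where f: "path_labelling f" by blast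
  then have bij: "bij_betw f {..<n} {..<n}" by (simp add: path_labelling_def)
  have "\<bar>real i - real j\<bar> \<le> resistance (f i) (f j)" if "i < n" "j < n" for i j
    using path_resistance_ge[OF f, of i j] path_resistance_ge[OF f, of j i] that
      resistance_commute[of "f i" "f j"] by (cases "i \<le> j") auto
  then have "(\<Sum>i<n. \<Sum>j<n. \<bar>real i - real j\<bar>) \<le> (\<Sum>i<n. \<Sum>j<n. resistance (f i) (f j))"
    by (intro sum_mono) auto
  also have "\<dots> = (\<Sum>a<n. \<Sum>b<n. resistance a b)"
    by (rule sum_sum_reindex_bij_betw[OF bij])
  finally have "2 * real n * (((real n)\<^sup>2 - 1) / 6) \<le> 2 * real n * sum_inverse"
    by (simp add: sum_abs_diff_lessThan sum_resistance power3_eq_cube power2_eq_square field_simps)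
  then have "((real n)\<^sup>2 - 1) / 6 \<le> sum_inverse" using n_pos by simp
  with sum_inverse_upper show "sum_inverse = ((real n)\<^sup>2 - 1) / 6" by simp
qed

end

section \<open>The Laplacian matrix of a graph\<close>

lemma proots_char_poly_diagonalized:
  fixes A :: "real mat"
  assumes A: "A \<in> carrier_mat n n" and U: "U \<in> carrier_mat n n"
    and UU: "transpose_mat U * U = 1\<^sub>m n" and UA: "transpose_mat U * A * U = mat_diag n e"
  shows "proots (char_poly A) = mset (map e [0..<n])"
proof -
  have Ut: "transpose_mat U \<in> carrier_mat n n" using U by simp
  have UU': "U * transpose_mat U = 1\<^sub>m n" by (rule mat_mult_left_right_inverse[OF Ut U UU])
  have "similar_mat (mat_diag n e) A"
    unfolding similar_mat_def
    by (rule exI[of _ "transpose_mat U"], rule exI[of _ U],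
        rule similar_mat_witI[OF UU UU' UA[symmetric] _ A Ut U]) simp
  then have "char_poly A = char_poly (mat_diag n e)" by (simp add: char_poly_similar)
  also have "\<dots> = (\<Prod>a\<leftarrow>diag_mat (mat_diag n e). [:- a, 1:])"
    by (rule char_poly_upper_triangular[of _ n]) (auto simp: mat_diag_def)
  also have "diag_mat (mat_diag n e) = map e [0..<n]"
    by (auto simp: diag_mat_def mat_diag_def)
  finally have cp: "char_poly A = prod_list (map (\<lambda>i. [:- e i, 1:]) [0..<n])" by (simp add: o_def)
  have "proots (prod_list (map (\<lambda>i. [:- e i, 1:]) is)) = mset (map e is)" for "is"
  proof (induction "is")
    case (Cons i "is")
    have "prod_list (map (\<lambda>i. [:- e i, 1:]) is) \<noteq> 0" by (auto simp: prod_list_zero_iff)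
    then have "proots (prod_list (map (\<lambda>i. [:- e i, 1:]) (i # is)))
        = proots [:- e i, 1:] + proots (prod_list (map (\<lambda>i. [:- e i, 1:]) is))"
      unfolding list.map prod_list.Cons by (intro proots_mult) auto
    then show ?case using Cons by simp
  qed simp
  then show ?thesis unfolding cp .
qed

text \<open>
  Leaving out the first sorted eigenvalue is the same as summing over all of them, since that
  eigenvalue is zero and \<open>inverse 0 = 0\<close>; the order then does not matter.
\<close>
lemma rho_ss_eq_sum_inverse:
  assumes L: "L \<in> carrier_mat n n" and roots: "proots (char_poly L) = mset (map e [0..<n])"
    and nonneg: "\<And>i. i < n \<Longrightarrow> 0 \<le> e i" and zero: "z < n" "e z = 0"
  shows "rho_ss L = 1 / 2 * (\<Sum>i<n. inverse (e i))"
proof -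
  define xs where "xs = sort (map e [0..<n])"
  have xs: "sorted_eigenvalues L = xs"
    unfolding sorted_eigenvalues_def roots xs_def by (rule sorted_list_of_multiset_mset)
  have len: "length xs = n" by (simp add: xs_def)
  have "set xs = e ` {..<n}" by (auto simp: xs_def)
  then have mem: "0 \<in> set xs" and ge: "\<And>x. x \<in> set xs \<Longrightarrow> 0 \<le> x"
    using zero nonneg by force+
  from mem obtain k where k: "k < n" "xs ! k = 0" using len by (auto simp: in_set_conv_nth)
  have "xs ! 0 \<le> xs ! k" using k len by (intro sorted_nth_mono) (auto simp: xs_def)
  moreover have "0 \<le> xs ! 0" using k len by (intro ge nth_mem) auto
  ultimately have xs0: "xs ! 0 = 0" using k by simp
  have "(\<Sum>i = 2..n. inverse (sorted_eigenvalue L i)) = (\<Sum>i = 1..<n. inverse (xs ! i))"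
    unfolding sorted_eigenvalue_def xs
    by (rule sum.reindex_bij_witness[of _ Suc "\<lambda>i. i - 1"]) auto
  also have "\<dots> = (\<Sum>i<n. inverse (xs ! i))"
    using k xs0 by (simp add: lessThan_atLeast0 sum.atLeast_Suc_lessThan)
  also have "\<dots> = sum_list (map inverse xs)"
    by (simp add: sum_list_sum_nth len lessThan_atLeast0)
  also have "\<dots> = sum_mset (image_mset inverse (mset xs))" by (simp flip: sum_mset_sum_list)
  also have "mset xs = mset (map e [0..<n])" by (simp add: xs_def)
  also have "sum_mset (image_mset inverse (mset (map e [0..<n]))) = (\<Sum>i<n. inverse (e i))"
    by (simp only: mset_map[symmetric] sum_mset_sum_list map_map)
      (simp add: interv_sum_list_conv_sum_set_nat lessThan_atLeast0)
  finally show ?thesis using L by (simp add: rho_ss_def)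
qed

definition index_adj :: "'a list \<Rightarrow> 'a pair_pre_digraph \<Rightarrow> nat \<Rightarrow> nat \<Rightarrow> bool" where
  "index_adj vs G i j \<longleftrightarrow> i < length vs \<and> j < length vs \<and> (vs ! i, vs ! j) \<in> parcs G"

context
  fixes G :: "'a pair_pre_digraph" and vs :: "'a list" and n :: nat
  assumes G: "pair_graph G" and vs: "distinct vs" "set vs = pverts G" and len: "length vs = n"
begin

interpretation pair_graph G by (rule G)

lemma index_adj_sym: "symp (index_adj vs G)"
  using graph_symmetric by (auto simp: symp_def index_adj_def)

lemma index_adj_irrefl: "\<not> index_adj vs G i i"
  using pair_no_loops by (fastforce simp: index_adj_def)

lemma out_degree_index_adj:
  assumes "i < n"
  shows "real (out_degree G (vs ! i)) = (\<Sum>j<n. if index_adj vs G i j then 1 else 0)"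
proof -
  have "out_arcs G (vs ! i) = (\<lambda>j. (vs ! i, vs ! j)) ` {j \<in> {..<n}. index_adj vs G i j}"
  proof (intro equalityI subsetI)
    fix p assume p: "p \<in> out_arcs G (vs ! i)"
    then have p: "p \<in> parcs G" "fst p = vs ! i" by auto
    then have "snd p \<in> set vs" using arc_snd_in_verts vs by simp
    then obtain j where "j < n" "vs ! j = snd p" using len by (auto simp: in_set_conv_nth)
    then show "p \<in> (\<lambda>j. (vs ! i, vs ! j)) ` {j \<in> {..<n}. index_adj vs G i j}"
      using p assms len by (cases p) (auto simp: index_adj_def)
  qed (auto simp: index_adj_def)
  moreover have "inj_on (\<lambda>j. (vs ! i, vs ! j)) {j \<in> {..<n}. index_adj vs G i j}"
    using vs len by (auto intro!: inj_onI simp: nth_eq_iff_index_eq)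
  ultimately have "out_degree G (vs ! i) = card {j \<in> {..<n}. index_adj vs G i j}"
    by (simp add: out_degree_def card_image)
  then show ?thesis by (simp add: sum.If_cases Int_def)
qed

lemma laplacian_entry:
  assumes "i < n" "j < n"
  shows "laplacian_mat vs G $$ (i, j)
    = (if i = j then (\<Sum>k<n. if index_adj vs G i k then 1 else 0) else 0)
      - (if index_adj vs G i j then 1 else 0)"
  unfolding out_degree_index_adj[OF assms(1), symmetric]
  using assms len
  by (simp add: laplacian_mat_def degree_mat_def adjacency_mat_def index_adj_def)

lemma laplacian_carrier: "laplacian_mat vs G \<in> carrier_mat n n"
  using len by (intro carrier_matI) (simp_all add: laplacian_mat_def degree_mat_def adjacency_mat_def)

lemma laplacian_symmetric: "transpose_mat (laplacian_mat vs G) = laplacian_mat vs G"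
proof (rule eq_matI)
  fix i j assume "i < dim_row (laplacian_mat vs G)" "j < dim_col (laplacian_mat vs G)"
  then have ij: "i < n" "j < n" using laplacian_carrier by auto
  then show "transpose_mat (laplacian_mat vs G) $$ (i, j) = laplacian_mat vs G $$ (i, j)"
    using laplacian_carrier laplacian_entry[OF ij] laplacian_entry[OF ij(2,1)]
      sympD[OF index_adj_sym, of i j] sympD[OF index_adj_sym, of j i] by auto
qed (use laplacian_carrier in auto)

text \<open>
  The degree terms \<open>x\<^sub>i\<^sup>2\<close> are symmetrized over both ends of each edge, which completes the
  square.
\<close>
lemma laplacian_quadratic_form:
  "(\<Sum>i<n. \<Sum>j<n. x i * laplacian_mat vs G $$ (i, j) * x j) = energy (index_adj vs G) {..<n} x"
proof -
  define s where "s i j = (if index_adj vs G i j then 1 else 0 :: real)" for i j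
  have s_sym: "s i j = s j i" for i j
    using sympD[OF index_adj_sym, of i j] sympD[OF index_adj_sym, of j i] by (auto simp: s_def)
  have swap: "(\<Sum>i<n. \<Sum>j<n. s i j * (x j)\<^sup>2) = (\<Sum>i<n. \<Sum>j<n. s i j * (x i)\<^sup>2)"
    by (subst sum.swap) (simp add: s_sym)
  have "(\<Sum>i<n. \<Sum>j<n. x i * laplacian_mat vs G $$ (i, j) * x j)
      = (\<Sum>i<n. \<Sum>j<n. (if j = i then (\<Sum>k<n. s i k) * (x i)\<^sup>2 else 0) - s i j * x i * x j)"
    by (intro sum.cong refl)
      (auto simp: laplacian_entry s_def[symmetric] power2_eq_square algebra_simps)
  also have "\<dots> = (\<Sum>i<n. \<Sum>j<n. s i j * (x i)\<^sup>2) - (\<Sum>i<n. \<Sum>j<n. s i j * x i * x j)"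
    by (simp add: sum_subtractf sum_distrib_right)
  also have "\<dots> = ((\<Sum>i<n. \<Sum>j<n. s i j * (x i)\<^sup>2) + (\<Sum>i<n. \<Sum>j<n. s i j * (x j)\<^sup>2)
      - 2 * (\<Sum>i<n. \<Sum>j<n. s i j * x i * x j)) / 2"
    unfolding swap by simp
  also have "\<dots> = (\<Sum>i<n. \<Sum>j<n. s i j * (x i - x j)\<^sup>2) / 2"
    by (simp add: sum.distrib[symmetric] sum_subtractf[symmetric] sum_distrib_left power2_diff algebra_simps)
  also have "\<dots> = energy (index_adj vs G) {..<n} x"
    unfolding energy_def s_def by (intro arg_cong2[of _ _ _ _ "(/)"] sum.cong refl) auto
  finally show ?thesis .
qed

text \<open>
  A set of indices without an edge to its complement is closed under reachability.
\<close>
lemma index_adj_connected: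
  assumes "connected (with_proj G)"
  shows "connected_on (index_adj vs G) {..<n}"
  unfolding connected_on_def
proof (intro allI impI, elim conjE)
  fix A assume A: "A \<subseteq> {..<n}" "A \<noteq> {}" "A \<noteq> {..<n}"
  show "\<exists>i\<in>A. \<exists>j\<in>{..<n} - A. index_adj vs G i j"
  proof (rule ccontr)
    assume closed: "\<not> (\<exists>i\<in>A. \<exists>j\<in>{..<n} - A. index_adj vs G i j)"
    let ?B = "(\<lambda>i. vs ! i) ` A"
    obtain a b where ab: "a \<in> A" "b \<in> {..<n} - A" using A by blast
    have "strongly_connected G"
      using symmetric_connected_imp_strongly_connected[OF _ assms] graph_symmetric sym_arcs by blast
    moreover have "vs ! a \<in> pverts G" "vs ! b \<in> pverts G"
      using ab A vs len nth_mem by (metis DiffD1 lessThan_iff subsetD)+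
    ultimately have "vs ! a \<rightarrow>\<^sup>*\<^bsub>G\<^esub> vs ! b" by (auto simp: strongly_connected_def)
    then have "(vs ! a, vs ! b) \<in> (parcs G)\<^sup>*"
      unfolding reachable_def using rtrancl_on_rtranclI by (metis with_proj_simps(3))
    then have "vs ! b \<in> ?B"
    proof (induction rule: rtrancl_induct)
      case base
      show ?case using ab by blast
    next
      case (step p q)
      then obtain i where i: "i \<in> A" "p = vs ! i" by blast
      have "q \<in> set vs" using step.hyps vs in_arcsD2 by simp
      then obtain j where j: "j < n" "q = vs ! j" using len by (auto simp: in_set_conv_nth)
      have "index_adj vs G i j" using i j step.hyps A len by (auto simp: index_adj_def)
      then have "j \<in> A" using closed i j by blast
      then show ?case using j by blast
    qed
    then obtain i where i: "i \<in> A" "vs ! b = vs ! i" by blast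
    then have "i = b" using vs ab A len by (metis DiffD1 lessThan_iff nth_eq_iff_index_eq subsetD)
    then show False using i ab by blast
  qed
qed

end

section \<open>Identification of the path graph and conclusion\<close>

text \<open>
  An isomorphism of digraphs carries separate maps for vertices, arcs and ends. Since arcs are
  pairs on both sides, the vertex map determines everything, and its inverse \<open>w\<close> lists the
  vertices along the path.
\<close>
lemma digraph_iso_path_graph_iff:
  assumes "pair_graph G"
  shows "digraph_iso (with_proj G) (with_proj (path_graph n)) \<longleftrightarrow>
    (\<exists>w. bij_betw w {..<n} (pverts G)
       \<and> (\<forall>i<n. \<forall>j<n. (w i, w j) \<in> parcs G \<longleftrightarrow> j = Suc i \<or> i = Suc j))"
proof -
  interpret pair_graph G by (rule assms)
  show ?thesis
  proof
    assume "digraph_iso (with_proj G) (with_proj (path_graph n))"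
    then obtain h where h: "digraph_isomorphism h"
      and eq: "with_proj (path_graph n) = app_iso h (with_proj G)"
      unfolding digraph_iso_def by blast
    \<comment> \<open>The end maps of the image are total functions, so equality of the records makes them projections.\<close>
    define g where "g = iso_verts h"
    have inj: "inj_on g (pverts G)" using h by (simp add: digraph_isomorphism_def g_def)
    have img: "g ` pverts G = {..<n}"
      using arg_cong[OF eq, of verts] by (simp add: path_graph_def g_def)
    have arcs: "iso_arcs h ` parcs G = parcs (path_graph n)"
      using arg_cong[OF eq, of arcs] by simp
    have ends: "iso_arcs h (p, q) = (g p, g q)" if "(p, q) \<in> parcs G" for p q
    proof -
      have "iso_tail h = fst" "iso_head h = snd"
        using arg_cong[OF eq, of tail] arg_cong[OF eq, of head] by simp_all
      then show ?thesis
        using h that by (fastforce simp: digraph_isomorphism_def g_def prod_eq_iff)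
    qed
    have edge: "(p, q) \<in> parcs G \<longleftrightarrow> (g p, g q) \<in> parcs (path_graph n)"
      if pq: "p \<in> pverts G" "q \<in> pverts G" for p q
    proof
      assume "(p, q) \<in> parcs G"
      then show "(g p, g q) \<in> parcs (path_graph n)" using arcs ends by (metis imageI)
    next
      assume "(g p, g q) \<in> parcs (path_graph n)"
      then obtain p' q' where "(p', q') \<in> parcs G" "iso_arcs h (p', q') = (g p, g q)"
        using arcs by (metis (no_types, lifting) imageE surj_pair)
      then have "(p', q') \<in> parcs G" "g p' = g p" "g q' = g q" using ends by auto
      then show "(p, q) \<in> parcs G"
        using inj pq in_arcsD1 in_arcsD2 by (metis inj_onD)
    qed
    have bij: "bij_betw g (pverts G) {..<n}" using inj img by (simp add: bij_betw_def)
    let ?w = "the_inv_into (pverts G) g"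
    have w: "?w i \<in> pverts G" "g (?w i) = i" if "i < n" for i
      using that inj img the_inv_into_into[of g "pverts G" i "pverts G"]
        f_the_inv_into_f[of g "pverts G" i] by auto
    show "\<exists>w. bij_betw w {..<n} (pverts G)
       \<and> (\<forall>i<n. \<forall>j<n. (w i, w j) \<in> parcs G \<longleftrightarrow> j = Suc i \<or> i = Suc j)"
      using bij_betw_the_inv_into[OF bij] edge w
      by (intro exI[of _ ?w] conjI) (auto simp: path_graph_def)
  next
    assume "\<exists>w. bij_betw w {..<n} (pverts G)
       \<and> (\<forall>i<n. \<forall>j<n. (w i, w j) \<in> parcs G \<longleftrightarrow> j = Suc i \<or> i = Suc j)"
    then obtain w where bij: "bij_betw w {..<n} (pverts G)"
      and edge: "\<And>i j. i < n \<Longrightarrow> j < n \<Longrightarrow> (w i, w j) \<in> parcs G \<longleftrightarrow> j = Suc i \<or> i = Suc j"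
      by blast
    define g where "g = the_inv_into {..<n} w"
    have gbij: "bij_betw g (pverts G) {..<n}"
      unfolding g_def by (rule bij_betw_the_inv_into[OF bij])
    have wg: "w (g p) = p" "g p < n" if "p \<in> pverts G" for p
      using that bij gbij f_the_inv_into_f_bij_betw[OF bij] bij_betwE[OF gbij]
      by (auto simp: g_def)
    have gw: "g (w i) = i" if "i < n" for i
      using that bij by (simp add: g_def the_inv_into_f_f bij_betw_def)
    define h where "h = \<lparr>iso_verts = g, iso_arcs = map_prod g g,
      iso_head = (snd :: nat \<times> nat \<Rightarrow> nat), iso_tail = fst\<rparr>"
    have ginj: "inj_on g (pverts G)" using gbij by (simp add: bij_betw_def)
    have "inj_on (map_prod g g) (parcs G)"
      by (rule inj_on_subset[OF map_prod_inj_on[OF ginj ginj]])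
        (use in_arcsD1 in_arcsD2 in auto)
    then have "digraph_isomorphism h"
      unfolding digraph_isomorphism_def using ginj wf_digraph by (auto simp: h_def)
    moreover have "with_proj (path_graph n) = app_iso h (with_proj G)"
    proof (rule pre_digraph.equality)
      show "verts (with_proj (path_graph n)) = verts (app_iso h (with_proj G))"
        using gbij by (simp add: path_graph_def h_def bij_betw_def)
      have "parcs (path_graph n) = map_prod g g ` parcs G"
      proof (intro equalityI subsetI)
        fix p assume "p \<in> parcs (path_graph n)"
        then obtain i j where ij: "p = (i, j)" "i < n" "j < n" "j = Suc i \<or> i = Suc j"
          by (auto simp: path_graph_def)
        then have "(w i, w j) \<in> parcs G" using edge by simp
        then show "p \<in> map_prod g g ` parcs G"
          using ij gw by (intro image_eqI[of _ _ "(w i, w j)"]) auto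
      next
        fix p assume "p \<in> map_prod g g ` parcs G"
        then obtain a b where ab: "p = (g a, g b)" "(a, b) \<in> parcs G" by auto
        then have "a \<in> pverts G" "b \<in> pverts G" using in_arcsD1 in_arcsD2 by auto
        then show "p \<in> parcs (path_graph n)"
          using ab wg edge[of "g a" "g b"] by (auto simp: path_graph_def)
      qed
      then show "arcs (with_proj (path_graph n)) = arcs (app_iso h (with_proj G))"
        by (simp add: h_def)
    qed (auto simp: h_def)
    ultimately show "digraph_iso (with_proj G) (with_proj (path_graph n))"
      unfolding digraph_iso_def by blast
  qed
qed

lemma sum_orthonormal_products:
  fixes u :: "nat \<Rightarrow> nat \<Rightarrow> real"
  assumes orth: "\<And>i j. i < n \<Longrightarrow> j < n \<Longrightarrow> (\<Sum>a<n. u i a * u j a) = (if i = j then 1 else 0)"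
  shows "(\<Sum>a<n. (\<Sum>i<n. c i * u i a) * (\<Sum>j<n. d j * u j a)) = (\<Sum>i<n. c i * d i)"
proof -
  have "(\<Sum>a<n. (\<Sum>i<n. c i * u i a) * (\<Sum>j<n. d j * u j a))
      = (\<Sum>a<n. \<Sum>i<n. \<Sum>j<n. c i * d j * (u i a * u j a))"
    by (simp add: sum_product mult_ac)
  also have "\<dots> = (\<Sum>i<n. \<Sum>a<n. \<Sum>j<n. c i * d j * (u i a * u j a))" by (rule sum.swap)
  also have "\<dots> = (\<Sum>i<n. \<Sum>j<n. \<Sum>a<n. c i * d j * (u i a * u j a))"
    by (intro sum.cong refl sum.swap)
  also have "\<dots> = (\<Sum>i<n. \<Sum>j<n. c i * d j * (\<Sum>a<n. u i a * u j a))"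
    by (simp only: sum_distrib_left)
  also have "\<dots> = (\<Sum>i<n. \<Sum>j<n. if j = i then c i * d i else 0)"
    by (intro sum.cong refl) (auto simp: orth)
  finally show ?thesis by simp
qed

text \<open>
  The eigenvectors are the columns of the orthogonal matrix that diagonalizes the Laplacian.
\<close>
lemma graph_laplacian_eigenbasis:
  assumes G: "pair_graph G" and conn: "connected (with_proj G)"
    and vs: "distinct vs" "set vs = pverts G" and len: "length vs = n"
  obtains e u where "laplacian_eigenbasis n (index_adj vs G) e u"
    and "proots (char_poly (laplacian_mat vs G)) = mset (map e [0..<n])"
proof -
  let ?L = "laplacian_mat vs G"
  have L: "?L \<in> carrier_mat n n" by (rule laplacian_carrier[OF G vs len])
  obtain U e where U: "U \<in> carrier_mat n n" and UU: "transpose_mat U * U = 1\<^sub>m n"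
    and UL: "transpose_mat U * ?L * U = mat_diag n e"
    using real_symmetric_diagonalization[OF L laplacian_symmetric[OF G vs len]] by blast
  define u where "u i a = U $$ (a, i)" for i a
  have Ut: "transpose_mat U \<in> carrier_mat n n" using U by simp
  have UU': "U * transpose_mat U = 1\<^sub>m n" by (rule mat_mult_left_right_inverse[OF Ut U UU])
  have orth: "(\<Sum>a<n. u i a * u j a) = (if i = j then 1 else 0)" if "i < n" "j < n" for i j
    using arg_cong[OF UU, of "\<lambda>M. M $$ (i, j)"] that U
    by (simp add: scalar_prod_def lessThan_atLeast0 u_def)
  have compl: "(\<Sum>i<n. u i a * u i b) = (if a = b then 1 else 0)" if "a < n" "b < n" for a b
    using arg_cong[OF UU', of "\<lambda>M. M $$ (a, b)"] that U
    by (simp add: scalar_prod_def lessThan_atLeast0 u_def)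
  have D: "mat_diag n e \<in> carrier_mat n n" by simp
  have "?L * U = (U * transpose_mat U) * (?L * U)" using L U by (simp add: UU')
  also have "\<dots> = U * (transpose_mat U * ?L * U)"
    using L U Ut by (simp add: assoc_mult_mat[of _ n n _ n _ n])
  finally have LU: "?L * U = U * mat_diag n e" by (simp add: UL)
  have eigen: "(\<Sum>b<n. ?L $$ (a, b) * u j b) = e j * u j a" if "a < n" "j < n" for a j
  proof -
    have "(\<Sum>b<n. ?L $$ (a, b) * u j b) = (?L * U) $$ (a, j)"
      using that L U by (simp add: scalar_prod_def lessThan_atLeast0 u_def)
    also have "\<dots> = e j * u j a"
      unfolding LU using that U by (simp add: mat_diag_mult_right u_def)
    finally show ?thesis .
  qed
  have energy: "energy (index_adj vs G) {..<n} (\<lambda>a. \<Sum>i<n. c i * u i a) = (\<Sum>i<n. e i * (c i)\<^sup>2)" for c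
  proof -
    let ?x = "\<lambda>a. \<Sum>i<n. c i * u i a"
    have Lx: "(\<Sum>b<n. ?L $$ (a, b) * ?x b) = (\<Sum>j<n. (c j * e j) * u j a)" if "a < n" for a
    proof -
      have "(\<Sum>b<n. ?L $$ (a, b) * ?x b) = (\<Sum>b<n. \<Sum>j<n. c j * (?L $$ (a, b) * u j b))"
        by (simp add: sum_distrib_left mult_ac)
      also have "\<dots> = (\<Sum>j<n. \<Sum>b<n. c j * (?L $$ (a, b) * u j b))" by (rule sum.swap)
      also have "\<dots> = (\<Sum>j<n. c j * (\<Sum>b<n. ?L $$ (a, b) * u j b))" by (simp add: sum_distrib_left)
      also have "\<dots> = (\<Sum>j<n. (c j * e j) * u j a)"
        using that by (intro sum.cong refl) (simp add: eigen)
      finally show ?thesis .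
    qed
    have "energy (index_adj vs G) {..<n} ?x = (\<Sum>a<n. \<Sum>b<n. ?x a * ?L $$ (a, b) * ?x b)"
      by (rule laplacian_quadratic_form[OF G vs len, symmetric])
    also have "\<dots> = (\<Sum>a<n. ?x a * (\<Sum>b<n. ?L $$ (a, b) * ?x b))"
      by (simp only: sum_distrib_left mult.assoc)
    also have "\<dots> = (\<Sum>a<n. ?x a * (\<Sum>j<n. (c j * e j) * u j a))"
      by (intro sum.cong refl) (simp add: Lx)
    also have "\<dots> = (\<Sum>i<n. c i * (c i * e i))" by (rule sum_orthonormal_products[OF orth])
    finally show ?thesis by (simp add: power2_eq_square mult_ac)
  qed
  have "pverts G \<noteq> {}"
    using conn by (auto simp: connected_def strongly_connected_def mk_symmetric_def)
  then have "0 < n" using vs len by auto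
  then have "laplacian_eigenbasis n (index_adj vs G) e u"
    using index_adj_sym[OF G vs len] index_adj_irrefl[OF G vs len] index_adj_connected[OF G vs len conn]
      orth compl energy by unfold_locales auto
  then show ?thesis using that proots_char_poly_diagonalized[OF L U UU UL] by blast
qed

theorem theorem3:
  fixes G :: "'a pair_pre_digraph" and vs :: "'a list" and n :: nat
  assumes "pair_graph G"
    and "connected (with_proj G)"
    and "card (pverts G) = n"
    and "distinct vs" and "set vs = pverts G"
  shows "1 / 2 - 1 / (2 * real n) \<le> rho_ss (laplacian_mat vs G)
    \<and> rho_ss (laplacian_mat vs G) \<le> ((real n)\<^sup>2 - 1) / 12
    \<and> (rho_ss (laplacian_mat vs G) = 1 / 2 - 1 / (2 * real n)
         \<longleftrightarrow> complete_digraph n (with_proj G))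
    \<and> (rho_ss (laplacian_mat vs G) = ((real n)\<^sup>2 - 1) / 12
         \<longleftrightarrow> digraph_iso (with_proj G) (with_proj (path_graph n)))"
proof -
  have len: "length vs = n" using assms by (metis distinct_card)
  obtain e u where basis: "laplacian_eigenbasis n (index_adj vs G) e u"
    and roots: "proots (char_poly (laplacian_mat vs G)) = mset (map e [0..<n])"
    using graph_laplacian_eigenbasis[OF assms(1,2,4,5) len] by blast
  interpret laplacian_eigenbasis n "index_adj vs G" e u by (rule basis)
  interpret G: pair_graph G by (rule assms)
  obtain z where "z < n" "e z = 0" using unique_zero_eigenvalue by blast
  then have rho: "rho_ss (laplacian_mat vs G) = sum_inverse / 2"
    using rho_ss_eq_sum_inverse[OF laplacian_carrier[OF assms(1,4,5) len] roots e_nonneg]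
    by (simp add: sum_inverse_def)
  have nth: "bij_betw (\<lambda>i. vs ! i) {..<n} (pverts G)"
    using bij_betw_nth[OF assms(4), of "{..<n}" "pverts G"] len assms(5) by simp
  define q where "q = (real n - 1) / real n"
  have lower: "1 / 2 - 1 / (2 * real n) = q / 2"
    using n_pos by (simp add: q_def field_simps)
  have complete_iff: "complete_digraph n (with_proj G)
      \<longleftrightarrow> (\<forall>a<n. \<forall>b<n. a \<noteq> b \<longrightarrow> index_adj vs G a b)"
  proof
    assume "complete_digraph n (with_proj G)"
    then show "\<forall>a<n. \<forall>b<n. a \<noteq> b \<longrightarrow> index_adj vs G a b"
      using assms(4,5) len nth_mem[of _ vs]
      by (auto simp: complete_digraph_pair_def index_adj_def nth_eq_iff_index_eq)
  next
    assume all: "\<forall>a<n. \<forall>b<n. a \<noteq> b \<longrightarrow> index_adj vs G a b"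
    have arc: "(p, q) \<in> parcs G" if pq: "p \<in> pverts G" "q \<in> pverts G" "p \<noteq> q" for p q
    proof -
      from pq obtain a b where "a < n" "b < n" "p = vs ! a" "q = vs ! b"
        using assms(5) len by (metis in_set_conv_nth)
      then show ?thesis using all pq(3) by (auto simp: index_adj_def)
    qed
    have ends: "fst p \<in> pverts G" "snd p \<in> pverts G" "fst p \<noteq> snd p" if "p \<in> parcs G" for p
      using that by (rule G.arc_fst_in_verts G.arc_snd_in_verts G.pair_no_loops)+
    have "parcs G = {(u, v). (u, v) \<in> pverts G \<times> pverts G \<and> u \<noteq> v}"
    proof (rule Set.set_eqI)
      fix p
      show "p \<in> parcs G \<longleftrightarrow> p \<in> {(u, v). (u, v) \<in> pverts G \<times> pverts G \<and> u \<noteq> v}"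
        using arc[of "fst p" "snd p"] ends[of p] by (cases p) auto
    qed
    then show "complete_digraph n (with_proj G)"
      using assms(3) G.pair_finite_verts by (simp add: complete_digraph_pair_def)
  qed
  have path_iff: "digraph_iso (with_proj G) (with_proj (path_graph n)) \<longleftrightarrow> (\<exists>f. path_labelling f)"
    unfolding digraph_iso_path_graph_iff[OF assms(1)]
  proof (intro iffI; elim exE conjE)
    fix w assume w: "bij_betw w {..<n} (pverts G)"
      and edge: "\<forall>i<n. \<forall>j<n. (w i, w j) \<in> parcs G \<longleftrightarrow> j = Suc i \<or> i = Suc j"
    define f where "f = the_inv_into {..<n} (\<lambda>i. vs ! i) \<circ> w"
    have f: "bij_betw f {..<n} {..<n}"
      unfolding f_def by (rule bij_betw_trans[OF w bij_betw_the_inv_into[OF nth]])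
    have "vs ! f i = w i" if "i < n" for i
      using f_the_inv_into_f_bij_betw[OF nth, of "w i"] bij_betwE[OF w] that by (simp add: f_def)
    then have "path_labelling f"
      using f edge len bij_betwE[OF f] by (simp add: path_labelling_def index_adj_def)
    then show "\<exists>f. path_labelling f" by blast
  next
    fix f assume f: "path_labelling f"
    then have bij: "bij_betw f {..<n} {..<n}" by (simp add: path_labelling_def)
    then have "bij_betw (\<lambda>i. vs ! f i) {..<n} (pverts G)"
      using bij_betw_trans[OF bij nth] by (simp add: o_def)
    moreover have "\<forall>i<n. \<forall>j<n. (vs ! f i, vs ! f j) \<in> parcs G \<longleftrightarrow> j = Suc i \<or> i = Suc j"
      using f len bij_betwE[OF bij] by (simp add: path_labelling_def index_adj_def)
    ultimately show "\<exists>w. bij_betw w {..<n} (pverts G)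
       \<and> (\<forall>i<n. \<forall>j<n. (w i, w j) \<in> parcs G \<longleftrightarrow> j = Suc i \<or> i = Suc j)" by blast
  qed
  show ?thesis
    unfolding complete_iff path_iff rho lower
    unfolding sum_inverse_lower_eq_iff[symmetric] sum_inverse_upper_eq_iff[symmetric] q_def[symmetric]
    using sum_inverse_lower[folded q_def] sum_inverse_upper by auto
qed

end
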